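(* Consider the Ising model $\sigma$ on any finite graph $G(V,E)$ at inverse temperature $\beta$, with total average magnetization $M(\sigma)=\frac1{|V|}\sum_{v\in V}\sigma_v$. In the associated random cluster model FK$(p,2)$, let $\mathcal C_v$ be the cluster of the vertex $v\in V$. Then, for any random set $\mathcal U\subseteq V$ that is independent of $\sigma$, with revealment $\delta=\max_{j\in V}\mathbb P[j\in\mathcal U]$, $$\mathbb E\big[\mathsf{clue}(M\,|\,\mathcal U)\big]\le\delta\,\frac{\sum_{v\in V}\mathbb E\left[|\mathcal C_v|^2\right]}{\sum_{v\in V}\mathbb E\left[|\mathcal C_v|\right]}.$$ More generally, if $f:\{-1,1\}^V\to\mathbb R$ is odd, i.e. $f(-\omega)=-f(\omega)$, then $$\mathbb E\big[\mathsf{clue}(f\,|\,\mathcal U)\big]\le\delta\,\mathbb E\left[\max_{v\in V}|\mathcal C_v|\right].$$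
   Context: Ising model on a finite graph (zero field): $\mathbb P_\beta[\sigma]\propto\exp\big(\beta\sum_{(x,y)\in E}\sigma_x\sigma_y\big)$ on $\{-1,1\}^V$. Associated random cluster model FK$(p,2)$, $p=1-e^{-2\beta}$: the measure on $\omega\in\{0,1\}^E$ proportional to $2^{k(\omega)}\prod_{e\in E}p^{\omega(e)}(1-p)^{1-\omega(e)}$, where $k(\omega)$ is the number of clusters (connected components of the graph of edges with $\omega(e)=1$); assigning independent fair $\pm1$ coin flips to clusters yields the Ising model. Clue: $\mathsf{clue}(f\,|\,U):=\mathrm{Var}(\mathbb E[f\,|\,\mathcal F_U])/\mathrm{Var}(f)$, where $\mathcal F_U$ is generated by the spins in $U$ (clue $=0$ if $\mathrm{Var}(f)=0$); $\mathbb E[\mathsf{clue}(f\,|\,\mathcal U)]$ averages over the random set $\mathcal U$. *)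

theory Defs
  imports "HOL-Probability.Probability"
begin

locale finite_graph =
  fixes V :: "'v set" and E :: "'v set set"
  assumes finite_V: "finite V"
    and V_nonempty: "V \<noteq> {}"
    and edges: "\<And>e. e \<in> E \<Longrightarrow> e \<subseteq> V \<and> card e = 2"

text \<open>The probability measure on the finite set \<open>A\<close> (with all subsets measurable) whose point
  masses are proportional to \<open>w\<close>.\<close>

definition weighted_measure :: "'a set \<Rightarrow> ('a \<Rightarrow> real) \<Rightarrow> 'a measure" where
  "weighted_measure A w = point_measure A (\<lambda>x. ennreal (w x / (\<Sum>y\<in>A. w y)))"

definition spin_configs :: "'v set \<Rightarrow> ('v \<Rightarrow> real) set" where
  "spin_configs V = V \<rightarrow>\<^sub>E {-1, 1}"

text \<open>Edges are two-element sets, so \<open>\<Prod>x\<in>e. s x\<close> is the product of the spins at the two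
  endpoints of \<open>e\<close>, and each undirected edge is counted once.\<close>

definition ising :: "'v set \<Rightarrow> 'v set set \<Rightarrow> real \<Rightarrow> ('v \<Rightarrow> real) measure" where
  "ising V E \<beta> = weighted_measure (spin_configs V) (\<lambda>s. exp (\<beta> * (\<Sum>e\<in>E. \<Prod>x\<in>e. s x)))"

text \<open>Bond configurations in \<open>{0,1}\<^sup>E\<close> are identified with their sets \<open>\<omega> \<subseteq> E\<close> of open edges.\<close>

definition cluster :: "'v set \<Rightarrow> 'v set set \<Rightarrow> 'v \<Rightarrow> 'v set" where
  "cluster V \<omega> v = {w \<in> V. (v, w) \<in> {(x, y). {x, y} \<in> \<omega>}\<^sup>*}"

definition num_clusters :: "'v set \<Rightarrow> 'v set set \<Rightarrow> nat" where
  "num_clusters V \<omega> = card (cluster V \<omega> ` V)"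

definition random_cluster :: "'v set \<Rightarrow> 'v set set \<Rightarrow> real \<Rightarrow> nat \<Rightarrow> 'v set set measure" where
  "random_cluster V E p q = weighted_measure (Pow E)
     (\<lambda>\<omega>. real q ^ num_clusters V \<omega> * (\<Prod>e\<in>E. if e \<in> \<omega> then p else 1 - p))"

definition magnetization :: "'v set \<Rightarrow> ('v \<Rightarrow> real) \<Rightarrow> real" where
  "magnetization V s = (\<Sum>v\<in>V. s v) / real (card V)"

definition odd_on_spins :: "'v set \<Rightarrow> (('v \<Rightarrow> real) \<Rightarrow> real) \<Rightarrow> bool" where
  "odd_on_spins V f \<longleftrightarrow> (\<forall>s\<in>spin_configs V. f (\<lambda>v\<in>V. - s v) = - f s)"

definition spin_algebra :: "'w measure \<Rightarrow> ('w \<Rightarrow> 'v \<Rightarrow> real) \<Rightarrow> 'v set \<Rightarrow> 'w measure" where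
  "spin_algebra M \<sigma> U =
     sigma (space M) (\<Union>v\<in>U. {(\<lambda>x. \<sigma> x v) -` B \<inter> space M | B. B \<in> sets borel})"

definition clue ::
  "'w measure \<Rightarrow> ('w \<Rightarrow> 'v \<Rightarrow> real) \<Rightarrow> (('v \<Rightarrow> real) \<Rightarrow> real) \<Rightarrow> 'v set \<Rightarrow> real" where
  "clue M \<sigma> f U =
     (let F = (\<lambda>x. f (\<sigma> x)) in
      if prob_space.variance M F = 0 then 0
      else prob_space.variance M (real_cond_exp M (spin_algebra M \<sigma> U) F) / prob_space.variance M F)"

text \<open>\<open>prob_space.indep_var\<close> requires both random variables to take values in the same type.\<close>

definition indep_rvs ::
  "'w measure \<Rightarrow> 'a measure \<Rightarrow> ('w \<Rightarrow> 'a) \<Rightarrow> 'b measure \<Rightarrow> ('w \<Rightarrow> 'b) \<Rightarrow> bool" where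
  "indep_rvs M S X T Y \<longleftrightarrow> X \<in> measurable M S \<and> Y \<in> measurable M T \<and>
     prob_space.indep_set M {X -` A \<inter> space M | A. A \<in> sets S} {Y -` B \<inter> space M | B. B \<in> sets T}"

definition revealment :: "'w measure \<Rightarrow> 'v set \<Rightarrow> ('w \<Rightarrow> 'v set) \<Rightarrow> real" where
  "revealment M V \<U> = Max ((\<lambda>j. measure M {x \<in> space M. j \<in> \<U> x}) ` V)"

end

theory Submission
  imports Defs
begin

text \<open>For the magnetization, condition on the random cluster configuration \<open>\<omega>\<close>: the clusters carry
  independent fair signs, \<open>U\<close> reveals exactly the signs of the clusters that it meets, and a cluster
  \<open>C\<close> is met with probability at most \<open>\<delta> |C|\<close>.

  For odd \<open>f\<close> this conditioning is not enough, because \<open>E[f\<^sup>2 | \<omega>]\<close> may be positively correlated with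
  the size of the largest cluster. Instead, \<open>E[clue(f | U)] Var f = \<langle>f, T f\<rangle>\<close> for the self-adjoint
  operator \<open>T = E[P\<^sub>U]\<close>, where \<open>P\<^sub>U\<close> is the conditional expectation given the spins in \<open>U\<close>. Its norm on
  the mean-zero functions is at most its exponential growth rate in any norm, in particular in
  the norm that is the largest oscillation of \<open>f\<close> under a single spin flip. The oscillation of
  \<open>P\<^sub>U f\<close> at \<open>v\<close> vanishes unless \<open>v \<in> U\<close>, and for \<open>v \<in> U\<close> it is at most
  \<open>\<Sum>\<^sub>u osc\<^sub>u(f) I(v \<rightarrow> u)\<close>, where \<open>I(v \<rightarrow> u)\<close> is the influence of \<open>\<sigma>\<^sub>v\<close> on \<open>\<sigma>\<^sub>u\<close> when the rest of \<open>U\<close>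
  is pinned. By an inequality of Ding, Song and Sun this influence is largest without any pinning,
  where it is the correlation of \<open>\<sigma>\<^sub>v\<close> and \<open>\<sigma>\<^sub>u\<close>, that is, the probability that \<open>u\<close> is in the cluster
  of \<open>v\<close>. Hence \<open>T\<close> contracts oscillations by \<open>\<delta> max\<^sub>v E|C\<^sub>v|\<close>.\<close>

section \<open>Spin systems with pinned and free sites\<close>

definition agree :: "('v \<Rightarrow> real) \<Rightarrow> 'v set \<Rightarrow> bool" where
  "agree s e \<longleftrightarrow> (\<forall>x\<in>e. \<forall>y\<in>e. s x = s y)"

text \<open>Up to a constant factor this is the Ising weight, with \<open>k\<close> the exponential
  of twice the coupling of one bond. The multiset allows parallel bonds, so that an edge can be
  split into weaker ones.\<close>

definition bond_weight :: "real \<Rightarrow> 'v set multiset \<Rightarrow> ('v \<Rightarrow> real) \<Rightarrow> real" where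
  "bond_weight k L s = (\<Prod>e\<in>#L. if agree s e then k else 1)"

text \<open>The field at \<open>y\<close> is given by the a priori probability \<open>l y\<close> of the spin \<open>+1\<close>, so that \<open>l y = 1/2\<close> is a
  zero field and \<open>l y \<in> {0, 1}\<close> pins the spin.\<close>

definition site_weight :: "'v set \<Rightarrow> ('v \<Rightarrow> real) \<Rightarrow> ('v \<Rightarrow> real) \<Rightarrow> real" where
  "site_weight V l s = (\<Prod>y\<in>V. if s y = 1 then l y else 1 - l y)"

definition flip :: "'v set \<Rightarrow> ('v \<Rightarrow> real) \<Rightarrow> 'v \<Rightarrow> real" where
  "flip R s = (\<lambda>x. if x \<in> R then - s x else s x)"

text \<open>The value \<open>c\<close> is an a priori probability and not a spin: \<open>1\<close>
  pins to spin \<open>+1\<close> and \<open>0\<close> to spin \<open>-1\<close>.\<close>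

definition pin :: "'v set \<Rightarrow> real \<Rightarrow> ('v \<Rightarrow> real) \<Rightarrow> 'v \<Rightarrow> real" where
  "pin R c l = (\<lambda>x. if x \<in> R then c else l x)"

definition increasing_on_spins :: "'v set \<Rightarrow> (('v \<Rightarrow> real) \<Rightarrow> real) \<Rightarrow> bool" where
  "increasing_on_spins V g \<longleftrightarrow>
     (\<forall>s\<in>spin_configs V. \<forall>x\<in>V. s x = -1 \<longrightarrow> g s \<le> g (flip {x} s))"

lemma spin_configs_iff: "s \<in> spin_configs V \<longleftrightarrow> (\<forall>x\<in>V. s x = 1 \<or> s x = -1) \<and> s \<in> extensional V"
  by (auto simp: spin_configs_def PiE_iff)

lemma flip_flip [simp]: "flip R (flip R s) = s"
  by (auto simp: flip_def)

lemma flip_in_spin_configs: "R \<subseteq> V \<Longrightarrow> s \<in> spin_configs V \<Longrightarrow> flip R s \<in> spin_configs V"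
  by (fastforce simp: spin_configs_iff flip_def extensional_def)

lemma bij_betw_flip: "R \<subseteq> V \<Longrightarrow> bij_betw (flip R) (spin_configs V) (spin_configs V)"
  by (rule bij_betw_byWitness[where f' = "flip R"]) (auto simp: flip_in_spin_configs)

lemma sum_flip:
  "R \<subseteq> V \<Longrightarrow> (\<Sum>s\<in>spin_configs V. h (flip R s)) = (\<Sum>s\<in>spin_configs V. h s)"
  by (rule sum.reindex_bij_betw[OF bij_betw_flip])

lemma agree_pair: "agree s {x, y} \<longleftrightarrow> s x = s y"
  by (cases "s x = s y") (auto simp: agree_def)

lemma agree_flip:
  assumes "e \<subseteq> R \<or> e \<inter> R = {}"
  shows "agree (flip R s) e \<longleftrightarrow> agree s e"
proof -
  have "(\<forall>x\<in>e. x \<in> R) \<or> (\<forall>x\<in>e. x \<notin> R)" using assms by blast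
  then show ?thesis by (auto simp: agree_def flip_def)
qed

section \<open>Weighted sums and means over spin configurations\<close>

locale finite_spins =
  fixes V :: "'v set" and k :: real
  assumes finite_V: "finite V" and k_ge_1: "1 \<le> k"
begin

abbreviation \<Omega> where "\<Omega> \<equiv> spin_configs V"

abbreviation field01 :: "('v \<Rightarrow> real) \<Rightarrow> bool" where
  "field01 l \<equiv> (\<forall>y\<in>V. 0 \<le> l y \<and> l y \<le> 1)"

definition wsum :: "'v set multiset \<Rightarrow> ('v \<Rightarrow> real) \<Rightarrow> (('v \<Rightarrow> real) \<Rightarrow> real) \<Rightarrow> real" where
  "wsum L l g = (\<Sum>s\<in>\<Omega>. site_weight V l s * bond_weight k L s * g s)"

definition mean :: "'v set multiset \<Rightarrow> ('v \<Rightarrow> real) \<Rightarrow> (('v \<Rightarrow> real) \<Rightarrow> real) \<Rightarrow> real" where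
  "mean L l g = wsum L l g / wsum L l (\<lambda>_. 1)"

lemma finite_\<Omega>: "finite \<Omega>"
  unfolding spin_configs_def using finite_V by (intro finite_PiE) auto

lemma bond_weight_ge_1: "1 \<le> bond_weight k L s"
proof (induction L)
  case (add e L)
  have "1 * 1 \<le> (if agree s e then k else 1) * bond_weight k L s"
    using add k_ge_1 by (intro mult_mono) auto
  then show ?case by (simp add: bond_weight_def)
qed (simp add: bond_weight_def)

lemma bond_weight_nonneg: "0 \<le> bond_weight k L s"
  using bond_weight_ge_1[of L s] by linarith

lemma site_weight_nonneg: "field01 l \<Longrightarrow> 0 \<le> site_weight V l s"
  unfolding site_weight_def by (intro prod_nonneg) auto

lemma wsum_pos:
  assumes l: "field01 l"
  shows "0 < wsum L l (\<lambda>_. 1)"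
proof -
  \<comment> \<open>Following the likelier spin at each site keeps every factor at least
    \<open>1/2\<close>, also at pinned sites.\<close>
  define s where "s = (\<lambda>y\<in>V. if l y \<ge> 1/2 then 1 else -1 :: real)"
  have s: "s \<in> \<Omega>" by (auto simp: s_def spin_configs_iff)
  have "0 < site_weight V l s"
    unfolding site_weight_def by (intro prod_pos) (auto simp: s_def)
  then have "0 < site_weight V l s * bond_weight k L s"
    using bond_weight_ge_1[of L s] by (intro mult_pos_pos) auto
  then show ?thesis
    unfolding wsum_def using s finite_\<Omega>
    by (intro sum_pos2[where i = s]) (auto intro!: mult_nonneg_nonneg site_weight_nonneg bond_weight_nonneg l)
qed

lemma site_weight_upd:
  assumes "x \<in> V"
  shows "site_weight V (l(x := c)) s = (if s x = 1 then c else 1 - c) * site_weight (V - {x}) l s"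
proof -
  have "(\<Prod>y\<in>V - {x}. if s y = 1 then (l(x := c)) y else 1 - (l(x := c)) y) = site_weight (V - {x}) l s"
    unfolding site_weight_def by (intro prod.cong) auto
  then show ?thesis
    unfolding site_weight_def[of V] using finite_V assms by (subst prod.remove[of V x]) auto
qed

text \<open>The site weight is affine in the field at a single site, so any field at
  \<open>x\<close> is a mixture of the two pinnings of \<open>x\<close>.\<close>

lemma wsum_split:
  assumes "x \<in> V"
  shows "wsum L l g = l x * wsum L (l(x := 1)) g + (1 - l x) * wsum L (l(x := 0)) g"
proof -
  have "site_weight V l s = l x * site_weight V (l(x := 1)) s + (1 - l x) * site_weight V (l(x := 0)) s"
    for s
    using site_weight_upd[OF assms, of l "l x" s] by (simp add: site_weight_upd[OF assms])
  then have "site_weight V l s * bond_weight k L s * g s =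
      l x * (site_weight V (l(x := 1)) s * bond_weight k L s * g s)
      + (1 - l x) * (site_weight V (l(x := 0)) s * bond_weight k L s * g s)" for s
    by (metis (no_types, opaque_lifting) distrib_right mult.assoc)
  then show ?thesis
    unfolding wsum_def by (simp add: sum_distrib_left sum.distrib)
qed

lemma site_weight_pinned:
  assumes "x \<in> V" "l x = (1 + c) / 2" "c = 1 \<or> c = -1" "s x = 1 \<or> s x = -1" "site_weight V l s \<noteq> 0"
  shows "s x = c"
proof -
  have "(if s x = 1 then l x else 1 - l x) \<noteq> 0"
    using assms(1,5) finite_V unfolding site_weight_def by auto
  then show ?thesis using assms(2,3,4) by auto
qed

text \<open>Once both endpoints are pinned, it is determined whether they agree, so the bond is a
  constant factor and cancels in \<open>mean\<close>.\<close>

lemma wsum_bond: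
  assumes "r \<in> V" "x \<in> V" "r \<noteq> x" "l r = (1 + c) / 2" "l x = (1 + d) / 2"
    "c = 1 \<or> c = -1" "d = 1 \<or> d = -1"
  shows "wsum (add_mset {r, x} L) l g = (if c = d then k else 1) * wsum L l g"
proof -
  have "site_weight V l s * bond_weight k (add_mset {r, x} L) s * g s =
     (if c = d then k else 1) * (site_weight V l s * bond_weight k L s * g s)" if "s \<in> \<Omega>" for s
  proof (cases "site_weight V l s = 0")
    case False
    then have "s r = c" "s x = d"
      using site_weight_pinned assms that unfolding spin_configs_iff by blast+
    then have "agree s {r, x} \<longleftrightarrow> c = d" by (auto simp: agree_def)
    then show ?thesis by (simp add: bond_weight_def)
  qed simp
  then show ?thesis unfolding wsum_def sum_distrib_left by (rule sum.cong[OF refl])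
qed

lemma bond_weight_flip:
  assumes "\<And>e. e \<in># L \<Longrightarrow> e \<subseteq> R \<or> e \<inter> R = {}"
  shows "bond_weight k L (flip R s) = bond_weight k L s"
  unfolding bond_weight_def
  by (intro arg_cong[where f = prod_mset] image_mset_cong) (simp add: agree_flip assms)

lemma site_weight_flip:
  assumes "R \<subseteq> V" "s \<in> \<Omega>"
  shows "site_weight V l (flip R s) = site_weight V (\<lambda>x. if x \<in> R then 1 - l x else l x) s"
  unfolding site_weight_def
  by (intro prod.cong) (use assms in \<open>auto simp: flip_def spin_configs_iff\<close>)

text \<open>A spin-flip symmetry localised to a region that no bond crosses: bond weights stay the
  same and the field inside is mirrored. It settles the case without crossing bonds in both
  inductions below and, with \<open>R = V\<close>, gives the sign symmetry at zero field.\<close>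

lemma wsum_flip:
  assumes "R \<subseteq> V" "\<And>e. e \<in># L \<Longrightarrow> e \<subseteq> R \<or> e \<inter> R = {}"
  shows "wsum L l g = wsum L (\<lambda>x. if x \<in> R then 1 - l x else l x) (\<lambda>s. g (flip R s))"
proof -
  have "wsum L l g = (\<Sum>s\<in>\<Omega>. site_weight V l (flip R s) * bond_weight k L (flip R s) * g (flip R s))"
    unfolding wsum_def by (rule sum_flip[OF assms(1), symmetric])
  also have "\<dots> = wsum L (\<lambda>x. if x \<in> R then 1 - l x else l x) (\<lambda>s. g (flip R s))"
    unfolding wsum_def by (intro sum.cong) (simp_all add: site_weight_flip bond_weight_flip assms)
  finally show ?thesis .
qed

lemma mean_flip:
  assumes "R \<subseteq> V" "\<And>e. e \<in># L \<Longrightarrow> e \<subseteq> R \<or> e \<inter> R = {}"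
  shows "mean L l g = mean L (\<lambda>x. if x \<in> R then 1 - l x else l x) (\<lambda>s. g (flip R s))"
  unfolding mean_def using wsum_flip[OF assms, where l = l and g = g] wsum_flip[OF assms, where l = l and g = "\<lambda>_. 1"] by simp

lemma mean_mono:
  assumes l: "field01 l"
    and le: "\<And>s. s \<in> \<Omega> \<Longrightarrow> site_weight V l s \<noteq> 0 \<Longrightarrow> g s \<le> h s"
  shows "mean L l g \<le> mean L l h"
proof -
  have "wsum L l g \<le> wsum L l h"
    unfolding wsum_def
  proof (intro sum_mono)
    fix s assume s: "s \<in> \<Omega>"
    show "site_weight V l s * bond_weight k L s * g s \<le> site_weight V l s * bond_weight k L s * h s"
    proof (cases "site_weight V l s = 0")
      case False
      then show ?thesis using le[OF s] site_weight_nonneg[OF l] bond_weight_ge_1[of L s]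
        by (intro mult_left_mono mult_nonneg_nonneg site_weight_nonneg bond_weight_nonneg) (auto simp: l)
    qed simp
  qed
  then show ?thesis unfolding mean_def using wsum_pos[where l = l and L = L, OF l] by (simp add: divide_right_mono)
qed

lemma mean_cong:
  assumes "\<And>s. s \<in> \<Omega> \<Longrightarrow> site_weight V l s \<noteq> 0 \<Longrightarrow> g s = h s"
  shows "mean L l g = mean L l h"
proof -
  have "wsum L l g = wsum L l h"
    unfolding wsum_def by (intro sum.cong) (use assms in auto)
  then show ?thesis by (simp add: mean_def)
qed

lemma mean_cong_field:
  assumes "\<And>y. y \<in> V \<Longrightarrow> l y = l' y"
  shows "mean L l g = mean L l' g"
proof -
  have "site_weight V l = site_weight V l'"
    by (rule ext) (auto simp: site_weight_def assms intro!: prod.cong)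
  then show ?thesis by (simp add: mean_def wsum_def)
qed

end

section \<open>Positive association and the influence inequality\<close>

text \<open>Here \<open>a1 : b1\<close> and \<open>a2 : b2\<close> are the odds at a site
  \<open>x\<close> given root \<open>+\<close> and root \<open>-\<close>, and \<open>uij\<close> is
  a mean given root \<open>i\<close> and \<open>x = j\<close>. A bond from the root to
  \<open>x\<close> favours \<open>+\<close> under root \<open>+\<close> and \<open>-\<close> under
  root \<open>-\<close>, so the order of the odds survives as \<open>B \<le> A\<close>. Both sides
  are averages with these weights, and the \<open>u\<close> are ordered in both indices.\<close>

lemma add_bond_increasing:
  fixes a1 b1 a2 b2 k :: real
  assumes nn: "0 \<le> a1" "0 \<le> b1" "0 \<le> a2" "0 \<le> b2" and pos: "0 < a1 + b1" "0 < a2 + b2"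
    and k: "1 \<le> k" and odds: "a2 / (a2 + b2) \<le> a1 / (a1 + b1)"
    and u: "u00 \<le> u01" "u01 \<le> u11" "u00 \<le> u10"
  shows "(a2 * u01 + k * b2 * u00) / (a2 + k * b2) \<le> (k * a1 * u11 + b1 * u10) / (k * a1 + b1)"
proof -
  define A where "A = k * a1 / (k * a1 + b1)"
  define B where "B = a2 / (a2 + k * b2)"
  have posA: "0 < k * a1 + b1"
    using nn pos k mult_right_mono[of 1 k a1] by linarith
  have posB: "0 < a2 + k * b2"
    using nn pos k mult_right_mono[of 1 k b2] by linarith
  have "a2 * b1 \<le> a1 * b2"
    using odds pos by (simp add: field_simps)
  moreover have "a1 * b2 * 1 \<le> a1 * b2 * (k * k)"
    using nn k mult_mono[of 1 k 1 k] by (intro mult_left_mono) auto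
  ultimately have "a2 * b1 \<le> k * a1 * (k * b2)" by (simp add: algebra_simps)
  then have AB: "B \<le> A"
    unfolding A_def B_def using posA posB by (simp add: field_simps)
  have A01: "0 \<le> A" "0 \<le> 1 - A"
    unfolding A_def using nn k posA by (auto simp: field_simps)
  have A': "1 - A = b1 / (k * a1 + b1)" and B': "1 - B = k * b2 / (a2 + k * b2)"
    unfolding A_def B_def using posA posB by (auto simp: field_simps)
  have "(a2 * u01 + k * b2 * u00) / (a2 + k * b2) = B * u01 + (1 - B) * u00"
    unfolding B' by (simp add: B_def add_divide_distrib)
  also have "\<dots> = u00 + B * (u01 - u00)" by (simp add: algebra_simps)
  also have "\<dots> \<le> u00 + A * (u01 - u00)"
    using AB u by (intro add_left_mono mult_right_mono) auto
  also have "\<dots> = A * u01 + (1 - A) * u00" by (simp add: algebra_simps)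
  also have "\<dots> \<le> A * u11 + (1 - A) * u10"
    using A01 u by (intro add_mono mult_left_mono)
  also have "\<dots> = (k * a1 * u11 + b1 * u10) / (k * a1 + b1)"
    unfolding A' by (simp add: A_def add_divide_distrib)
  finally show ?thesis .
qed

text \<open>The heart of the influence inequality. A new bond between the root and a site \<open>x\<close> is added to a
  system in which \<open>a1 : b1\<close> and \<open>a2 : b2\<close> are the odds of the two spins at \<open>x\<close> given root \<open>+\<close> and
  root \<open>-\<close>, and \<open>uij\<close> is the mean spin at the target given root \<open>i\<close> and \<open>x = j\<close> (\<open>1\<close> for \<open>+\<close>, \<open>0\<close> for \<open>-\<close>).
  The assumption \<open>stationary\<close> says that the influence is critical as a function of the field
  at \<open>x\<close>. Together with \<open>k \<le> 2\<close> it makes \<open>F q - F p\<close> and \<open>X - Y\<close> have the same sign.\<close>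

lemma influence_step:
  fixes a1 b1 a2 b2 k :: real
  assumes pos: "0 < a1" "0 < b1" "0 < a2" "0 < b2" and k: "1 \<le> k" "k \<le> 2"
    and mono: "u10 \<le> u11" "u00 \<le> u01"
    and stationary: "a1 * b1 * (u11 - u10) / (k * a1 + b1)\<^sup>2 = a2 * b2 * (u01 - u00) / (a2 + k * b2)\<^sup>2"
    and N: "(a1 * u11 + b1 * u10) / (a1 + b1) - (a2 * u01 + b2 * u00) / (a2 + b2) \<le> N"
    and M: "u11 - u00 \<le> M" "N \<le> M"
    and p0: "a1 / (a1 + b1) + b2 / (a2 + b2) \<le> 2 * p0"
    and \<alpha>0: "\<alpha>0 = (k - 1) * p0 / (1 + (k - 1) * p0)"
  shows "(k * a1 * u11 + b1 * u10) / (k * a1 + b1) - (a2 * u01 + k * b2 * u00) / (a2 + k * b2)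
    \<le> \<alpha>0 * M + (1 - \<alpha>0) * N"
proof -
  define c where "c = k - 1"
  \<comment> \<open>The probabilities that \<open>x\<close> agrees with a root \<open>+\<close> and
    with a root \<open>-\<close> are \<open>p\<close> and \<open>q\<close>. Adding the bond mixes a
    system in which agreement is forced, with weight \<open>F p\<close> or \<open>F q\<close>, with
    the system without the bond; \<open>X\<close> and \<open>Y\<close> are the gaps between the
    forced and the unbonded means.\<close>
  define p where "p = a1 / (a1 + b1)"
  define q where "q = b2 / (a2 + b2)"
  define X where "X = (1 - p) * (u11 - u10)"
  define Y where "Y = (1 - q) * (u01 - u00)"
  define F where "F = (\<lambda>t::real. c * t / (1 + c * t))"
  define \<alpha> where "\<alpha> = (F p + F q) / 2"
  have c: "0 \<le> c" "c \<le> 1" using k by (auto simp: c_def)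
  have p: "0 < p" "p < 1" and q: "0 < q" "q < 1"
    using pos by (auto simp: p_def q_def field_simps)
  have cp: "0 \<le> c * p" "c * p \<le> 1" "0 \<le> c * q" "c * q \<le> 1"
    using c p q by (auto intro: mult_nonneg_nonneg mult_le_one)
  have pp: "0 < 1 + c * p" "0 < 1 + c * q" using cp by linarith+
  have X: "0 \<le> X" and Y: "0 \<le> Y" using p q mono by (auto simp: X_def Y_def)
  have za: "k * a1 + b1 = (a1 + b1) * (1 + c * p)"
    using pos by (simp add: p_def c_def field_simps)
  have zb: "a2 + k * b2 = (a2 + b2) * (1 + c * q)"
    using pos by (simp add: q_def c_def field_simps)
  have first: "(k * a1 * u11 + b1 * u10) / (k * a1 + b1) = u11 - (1 - F p) * X"
  proof -
    have "1 - F p = 1 / (1 + c * p)" using pp by (simp add: F_def field_simps)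
    moreover have "1 - p = b1 / (a1 + b1)" using pos by (simp add: p_def field_simps)
    ultimately have "(1 - F p) * X = (b1 / (a1 + b1)) * (u11 - u10) / (1 + c * p)"
      by (simp add: X_def)
    also have "\<dots> = b1 * (u11 - u10) / (k * a1 + b1)"
      unfolding za using pos pp by (simp add: field_simps)
    finally show ?thesis using pos k add_pos_pos[of "k * a1" b1] by (simp add: field_simps)
  qed
  have second: "(a2 * u01 + k * b2 * u00) / (a2 + k * b2) = u00 + (1 - F q) * Y"
  proof -
    have "1 - F q = 1 / (1 + c * q)" using pp by (simp add: F_def field_simps)
    moreover have "1 - q = a2 / (a2 + b2)" using pos by (simp add: q_def field_simps)
    ultimately have "(1 - F q) * Y = (a2 / (a2 + b2)) * (u01 - u00) / (1 + c * q)"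
      by (simp add: Y_def)
    also have "\<dots> = a2 * (u01 - u00) / (a2 + k * b2)"
      unfolding zb using pos pp by (simp add: field_simps)
    finally show ?thesis using pos k add_pos_pos[of a2 "k * b2"] by (simp add: field_simps)
  qed
  have N': "u11 - X - (u00 + Y) \<le> N"
  proof -
    have "(a1 * u11 + b1 * u10) / (a1 + b1) = u11 - X"
      using pos by (simp add: X_def p_def field_simps)
    moreover have "(a2 * u01 + b2 * u00) / (a2 + b2) = u00 + Y"
      using pos by (simp add: Y_def q_def field_simps)
    ultimately show ?thesis using N by simp
  qed
  have st: "X * (p / (1 + c * p)\<^sup>2) = Y * (q / (1 + c * q)\<^sup>2)"
  proof -
    have "X * (p / (1 + c * p)\<^sup>2) = a1 * b1 * (u11 - u10) / (k * a1 + b1)\<^sup>2"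
      unfolding za X_def p_def[symmetric]
      using pos pp p_def by (simp add: p_def field_simps power2_eq_square)
    moreover have "Y * (q / (1 + c * q)\<^sup>2) = a2 * b2 * (u01 - u00) / (a2 + k * b2)\<^sup>2"
      unfolding zb Y_def
      using pos pp q_def by (simp add: q_def field_simps power2_eq_square)
    ultimately show ?thesis using stationary by simp
  qed
  \<comment> \<open>The function \<open>t / (1 + c * t)\<^sup>2\<close> increases up to
    \<open>1 / c\<close>. The hypothesis \<open>k \<le> 2\<close> gives \<open>c \<le> 1\<close>, so
    it increases on the whole unit interval.\<close>
  have Gmono: "s / (1 + c * s)\<^sup>2 \<le> t / (1 + c * t)\<^sup>2" if "0 < s" "s \<le> t" "t \<le> 1" for s t
  proof -
    have "c * c \<le> 1" "s * t \<le> 1" "0 \<le> s * t" using c that by (auto intro: mult_le_one)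
    then have "(c * c) * (s * t) \<le> 1" using mult_le_one[of "c * c" "s * t"] by simp
    then have "0 \<le> (t - s) * (1 - (c * c) * (s * t))" using that by (intro mult_nonneg_nonneg) auto
    then have "s * (1 + c * t)\<^sup>2 \<le> t * (1 + c * s)\<^sup>2"
      by (simp add: algebra_simps power2_eq_square)
    moreover have "0 < 1 + c * s" "0 < 1 + c * t"
      using c that by (simp_all add: add_pos_nonneg)
    then have "0 < (1 + c * s)\<^sup>2" "0 < (1 + c * t)\<^sup>2"
      by (auto intro!: zero_less_power)
    ultimately show ?thesis by (simp add: field_simps)
  qed
  have Fmono: "F s \<le> F t" if "0 \<le> s" "s \<le> t" for s t
  proof -
    have "0 < 1 + c * s" "0 < 1 + c * t" using c that by (auto intro!: add_pos_nonneg)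
    then show ?thesis
      unfolding F_def using mult_left_mono[OF that(2) c(1)] by (simp add: field_simps)
  qed
  \<comment> \<open>By \<open>st\<close> and \<open>Gmono\<close> the larger of the gaps
    \<open>X\<close> and \<open>Y\<close> belongs to the smaller of \<open>p\<close> and
    \<open>q\<close>.\<close>
  have XY: "0 \<le> (F q - F p) * (X - Y)"
  proof (cases "p \<le> q")
    case True
    have "0 < p / (1 + c * p)\<^sup>2" using p pp by simp
    moreover have "X * (p / (1 + c * p)\<^sup>2) \<ge> Y * (p / (1 + c * p)\<^sup>2)"
      unfolding st using Gmono[of p q] True p q Y by (intro mult_left_mono) auto
    ultimately have "Y \<le> X" by (rule mult_right_le_imp_le[rotated])
    then show ?thesis using Fmono[of p q] True p by simp
  next
    case False
    have "0 < q / (1 + c * q)\<^sup>2" using q pp by simp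
    moreover have "Y * (q / (1 + c * q)\<^sup>2) \<ge> X * (q / (1 + c * q)\<^sup>2)"
      unfolding st[symmetric] using Gmono[of q p] False p q X by (intro mult_left_mono) auto
    ultimately have "X \<le> Y" by (rule mult_right_le_imp_le[rotated])
    then show ?thesis using Fmono[of q p] False q by (simp add: mult_nonpos_nonpos)
  qed
  have F1: "0 \<le> F t" "F t \<le> 1" if "0 \<le> t" for t
    using that c by (auto simp: F_def field_simps add_pos_nonneg)
  have \<alpha>: "0 \<le> \<alpha>" "\<alpha> \<le> 1" using F1[of p] F1[of q] p q by (auto simp: \<alpha>_def)
  \<comment> \<open>Concavity of \<open>F\<close>, as the inequality between the harmonic and the
    arithmetic mean of \<open>P\<close> and \<open>Q\<close>.\<close>
  have "\<alpha> \<le> F ((p + q) / 2)"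
  proof -
    define P where "P = 1 + c * p"
    define Q where "Q = 1 + c * q"
    have PQ: "0 < P" "0 < Q" using pp by (auto simp: P_def Q_def)
    have "F p = 1 - 1 / P" "F q = 1 - 1 / Q" using PQ by (auto simp: F_def P_def Q_def field_simps)
    moreover have "F ((p + q) / 2) = 1 - 1 / ((P + Q) / 2)"
      using PQ unfolding F_def P_def Q_def by (simp add: field_simps)
    moreover have "1 / ((P + Q) / 2) \<le> (1 / P + 1 / Q) / 2"
    proof -
      have "4 * (P * Q) \<le> (P + Q) * (P + Q)"
        using zero_le_square[of "P - Q"] by (simp add: algebra_simps)
      then show ?thesis using PQ by (simp add: field_simps)
    qed
    ultimately show ?thesis by (simp add: \<alpha>_def)
  qed
  also have "\<dots> \<le> F p0" using p0 p q by (intro Fmono) (auto simp: p_def q_def)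
  finally have \<alpha>0': "\<alpha> \<le> \<alpha>0" by (simp add: \<alpha>0 F_def c_def)
  \<comment> \<open>Replacing \<open>F p\<close> and \<open>F q\<close> by their average
    \<open>\<alpha>\<close> leaves one cross term, and \<open>XY\<close> fixes its sign. The passage
    from \<open>\<alpha>\<close> to \<open>\<alpha>0\<close> at the end is allowed because
    \<open>N \<le> M\<close>.\<close>
  have "(k * a1 * u11 + b1 * u10) / (k * a1 + b1) - (a2 * u01 + k * b2 * u00) / (a2 + k * b2)
      = u11 - u00 - (1 - \<alpha>) * (X + Y) - (F q - F p) * (X - Y) / 2"
    unfolding first second \<alpha>_def by (simp add: field_simps)
  also have "\<dots> \<le> u11 - u00 - (1 - \<alpha>) * (X + Y)" using XY by simp
  also have "\<dots> = \<alpha> * (u11 - u00) + (1 - \<alpha>) * (u11 - X - (u00 + Y))"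
    by (simp add: algebra_simps)
  also have "\<dots> \<le> \<alpha> * M + (1 - \<alpha>) * N"
    using \<alpha> M N' by (intro add_mono mult_left_mono) auto
  also have "\<dots> = N + \<alpha> * (M - N)" by (simp add: algebra_simps)
  also have "\<dots> \<le> N + \<alpha>0 * (M - N)"
    using \<alpha>0' M by (intro add_left_mono mult_right_mono) auto
  also have "\<dots> = \<alpha>0 * M + (1 - \<alpha>0) * N" by (simp add: algebra_simps)
  finally show ?thesis .
qed

text \<open>The same mixture as an exact identity: forced agreement with weight
  \<open>\<alpha>\<close>, no bond otherwise. At zero field it evaluates the right-hand side of
  \<open>influence_step\<close>.\<close>

lemma mean_bond_algebra:
  fixes a b k :: real
  assumes pos: "0 < a" "0 < b" and k: "1 \<le> k" and p: "p = a / (a + b)"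
    and \<alpha>: "\<alpha> = (k - 1) * p / (1 + (k - 1) * p)" and U: "U = (a * u + b * v) / (a + b)"
  shows "(k * a * u + b * v) / (k * a + b) = \<alpha> * u + (1 - \<alpha>) * U"
proof -
  have pp: "0 < 1 + (k - 1) * p" using pos k by (auto simp: p add_pos_nonneg)
  have pa: "(a + b) * p = a" using pos by (simp add: p)
  have Ua: "(a + b) * U = a * u + b * v" using pos by (simp add: U)
  have "1 - \<alpha> = 1 / (1 + (k - 1) * p)" using pp by (simp add: \<alpha> field_simps)
  then have "\<alpha> * u + (1 - \<alpha>) * U = ((k - 1) * p * u + U) / (1 + (k - 1) * p)"
    by (simp add: \<alpha> add_divide_distrib)
  also have "\<dots> = ((a + b) * ((k - 1) * p * u + U)) / ((a + b) * (1 + (k - 1) * p))"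
    using pos by simp
  also have "(a + b) * ((k - 1) * p * u + U) = (k - 1) * ((a + b) * p) * u + (a + b) * U"
    by (simp only: distrib_left mult_ac)
  also have "\<dots> = k * a * u + b * v"
    unfolding pa Ua by (simp add: algebra_simps)
  also have "(a + b) * (1 + (k - 1) * p) = (a + b) + (k - 1) * ((a + b) * p)"
    by (simp only: distrib_left mult_ac mult_1_right)
  also have "\<dots> = k * a + b" unfolding pa by (simp add: algebra_simps)
  finally show ?thesis ..
qed

definition bonds_in :: "'v set \<Rightarrow> 'v set multiset \<Rightarrow> bool" where
  "bonds_in V L \<longleftrightarrow> (\<forall>e\<in>#L. e \<subseteq> V \<and> card e = 2)"

lemma bonds_in_add [simp]: "bonds_in V (add_mset e L) \<longleftrightarrow> e \<subseteq> V \<and> card e = 2 \<and> bonds_in V L"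
  by (auto simp: bonds_in_def)

text \<open>Orients a crossing bond from inside \<open>R\<close> to outside and removes it, which is
  the reduction step of the inductions on the number of bonds.\<close>

lemma crossing_bond:
  assumes "bonds_in V L" "e \<in># L" "\<not> (e \<subseteq> R \<or> e \<inter> R = {})"
  obtains r x L' where "L = add_mset {r, x} L'" "r \<in> R" "x \<notin> R" "r \<in> V" "x \<in> V" "bonds_in V L'"
    "size L' < size L"
proof -
  obtain a b where ab: "e = {a, b}" "a \<noteq> b"
    using assms(1,2) by (auto simp: bonds_in_def card_2_iff)
  obtain L' where L: "L = add_mset e L'" using assms(2) by (metis multi_member_split)
  have "bonds_in V L'" "a \<in> V" "b \<in> V" using assms(1) by (auto simp: L ab)
  then show thesis
    using that[of a b L'] that[of b a L'] assms(3) by (auto simp: L ab insert_commute)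
qed

section \<open>One-bond expansions and positive association\<close>

context finite_spins
begin

lemma wsum_mean: "field01 l \<Longrightarrow> wsum L l g = wsum L l (\<lambda>_. 1) * mean L l g"
  using wsum_pos[of l L] by (simp add: mean_def)

lemma mean_split:
  assumes "x \<in> V" "field01 l"
  shows "mean L l g =
    (l x * wsum L (l(x := 1)) (\<lambda>_. 1) * mean L (l(x := 1)) g
     + (1 - l x) * wsum L (l(x := 0)) (\<lambda>_. 1) * mean L (l(x := 0)) g)
    / (l x * wsum L (l(x := 1)) (\<lambda>_. 1) + (1 - l x) * wsum L (l(x := 0)) (\<lambda>_. 1))"
  unfolding mean_def[of L l] wsum_split[OF assms(1), of L l]
  using assms(2) by (simp add: wsum_mean[of "l(x := 1)" L g] wsum_mean[of "l(x := 0)" L g] mult.assoc)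

lemma wsum_bond_1:
  assumes "r \<in> V" "x \<in> V" "r \<noteq> x" "l r = 1"
  shows "wsum (add_mset {r, x} L) l g = k * l x * wsum L (l(x := 1)) g + (1 - l x) * wsum L (l(x := 0)) g"
  unfolding wsum_split[OF assms(2), of "add_mset {r, x} L" l]
  using wsum_bond[of r x "l(x := 1)" 1 1 L g] wsum_bond[of r x "l(x := 0)" 1 "-1" L g] assms by simp

lemma wsum_bond_0:
  assumes "r \<in> V" "x \<in> V" "r \<noteq> x" "l r = 0"
  shows "wsum (add_mset {r, x} L) l g = l x * wsum L (l(x := 1)) g + k * (1 - l x) * wsum L (l(x := 0)) g"
  unfolding wsum_split[OF assms(2), of "add_mset {r, x} L" l]
  using wsum_bond[of r x "l(x := 1)" "-1" 1 L g] wsum_bond[of r x "l(x := 0)" "-1" "-1" L g] assms by simp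

lemma mean_bond_1:
  assumes "r \<in> V" "x \<in> V" "r \<noteq> x" "l r = 1" "field01 l"
  shows "mean (add_mset {r, x} L) l g =
    (k * (l x * wsum L (l(x := 1)) (\<lambda>_. 1)) * mean L (l(x := 1)) g
     + (1 - l x) * wsum L (l(x := 0)) (\<lambda>_. 1) * mean L (l(x := 0)) g)
    / (k * (l x * wsum L (l(x := 1)) (\<lambda>_. 1)) + (1 - l x) * wsum L (l(x := 0)) (\<lambda>_. 1))"
  unfolding mean_def[of "add_mset {r, x} L"] wsum_bond_1[of r x l, OF assms(1-4)]
  using assms(5) by (simp add: wsum_mean[of "l(x := 1)" L g] wsum_mean[of "l(x := 0)" L g] mult.assoc)

lemma mean_bond_0:
  assumes "r \<in> V" "x \<in> V" "r \<noteq> x" "l r = 0" "field01 l"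
  shows "mean (add_mset {r, x} L) l g =
    (l x * wsum L (l(x := 1)) (\<lambda>_. 1) * mean L (l(x := 1)) g
     + k * ((1 - l x) * wsum L (l(x := 0)) (\<lambda>_. 1)) * mean L (l(x := 0)) g)
    / (l x * wsum L (l(x := 1)) (\<lambda>_. 1) + k * ((1 - l x) * wsum L (l(x := 0)) (\<lambda>_. 1)))"
  unfolding mean_def[of "add_mset {r, x} L"] wsum_bond_0[of r x l, OF assms(1-4)]
  using assms(5) by (simp add: wsum_mean[of "l(x := 1)" L g] wsum_mean[of "l(x := 0)" L g] mult.assoc)

lemma mean_const: "field01 l \<Longrightarrow> mean L l (\<lambda>_. c) = c"
  using wsum_pos[of l L] unfolding mean_def wsum_def by (simp add: sum_distrib_right[symmetric])

lemma mean_uminus: "mean L l (\<lambda>s. - g s) = - mean L l g"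
  by (simp add: mean_def wsum_def sum_negf)

lemma mean_pinned:
  assumes "x \<in> V" "field01 l" "l x = (1 + c) / 2" "c = 1 \<or> c = -1"
  shows "mean L l (\<lambda>s. s x) = c"
  using mean_cong[of l "\<lambda>s. s x" "\<lambda>_. c" L] site_weight_pinned[where x = x and l = l and c = c] assms
  by (auto simp: spin_configs_iff mean_const)

text \<open>Positive association in terms of the field, by induction on the number of bonds. If no
  bond leaves \<open>x\<close>, flipping \<open>x\<close> alone maps one pinned measure to the
  other. Otherwise a bond from \<open>x\<close> to some \<open>y\<close> is removed, and
  \<open>add_bond_increasing\<close> restores it.\<close>

lemma mean_increasing:
  assumes "bonds_in V L" "x \<in> V" "field01 l" "increasing_on_spins V g"
  shows "mean L (l(x := 0)) g \<le> mean L (l(x := 1)) g"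
  using assms
proof (induction "size L" arbitrary: L x l g rule: less_induct)
  case less
  show ?case
  proof (cases "\<forall>e\<in>#L. e \<subseteq> {x} \<or> e \<inter> {x} = {}")
    case True
    have "mean L (l(x := 0)) g \<le> mean L (l(x := 0)) (\<lambda>s. g (flip {x} s))"
    proof (rule mean_mono)
      show "field01 (l(x := 0))" using less.prems by auto
      fix s assume s: "s \<in> \<Omega>" "site_weight V (l(x := 0)) s \<noteq> 0"
      then have "s x = -1"
        using site_weight_pinned[of x "l(x := 0)" "-1" s] less.prems(2) by (auto simp: spin_configs_iff)
      then show "g s \<le> g (flip {x} s)" using less.prems(2,4) s by (auto simp: increasing_on_spins_def)
    qed
    also have "\<dots> = mean L (\<lambda>y. if y \<in> {x} then 1 - (l(x := 1)) y else (l(x := 1)) y) (\<lambda>s. g (flip {x} s))"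
      by (rule mean_cong_field) auto
    also have "\<dots> = mean L (l(x := 1)) g"
      using True less.prems(2) by (intro mean_flip[symmetric]) auto
    finally show ?thesis .
  next
    case False
    then obtain e where "e \<in># L" "\<not> (e \<subseteq> {x} \<or> e \<inter> {x} = {})" by blast
    then obtain r y L' where L': "L = add_mset {r, y} L'" "r \<in> {x}" "y \<notin> {x}" "y \<in> V" "bonds_in V L'"
      "size L' < size L"
      using crossing_bond[OF less.prems(1)] by metis
    define l1 where "l1 = l(x := 1)"
    define l0 where "l0 = l(x := 0)"
    have f: "field01 l1" "field01 l0" "field01 (l(y := 1))" "field01 (l(y := 0))"
      using less.prems(3) by (auto simp: l1_def l0_def)
    have ly: "l1 y = l y" "l0 y = l y" "0 \<le> l y" "l y \<le> 1"
      using L' less.prems(3) by (auto simp: l1_def l0_def)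
    let ?Z = "\<lambda>l. wsum L' l (\<lambda>_. 1)"
    have Z: "0 < ?Z (l1(y := 1))" "0 < ?Z (l1(y := 0))" "0 < ?Z (l0(y := 1))" "0 < ?Z (l0(y := 0))"
      using f by (auto intro!: wsum_pos)
    note IH = less.hyps[OF L'(6,5)]
    have com: "l1(y := c) = (l(y := c))(x := 1)" "l0(y := c) = (l(y := c))(x := 0)" for c
      using L' by (auto simp: l1_def l0_def)
    have u: "mean L' (l0(y := c)) g \<le> mean L' (l1(y := c)) g" if "0 \<le> c" "c \<le> 1" for c
      unfolding com using less.prems that by (intro IH) auto
    have v: "mean L' (l0(y := 0)) g \<le> mean L' (l0(y := 1)) g"
      using less.prems f(2) L' by (intro IH) auto
    \<comment> \<open>With the field at \<open>y\<close> left as it is, the mean of this indicator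
      is the probability of spin \<open>+\<close> at \<open>y\<close>. The induction hypothesis for
      it therefore orders the odds at \<open>y\<close>.\<close>
    let ?ind = "\<lambda>s::'v \<Rightarrow> real. if s y = 1 then 1 else 0 :: real"
    have "mean L' l0 ?ind \<le> mean L' l1 ?ind"
      unfolding l1_def l0_def using less.prems L' by (intro IH) (auto simp: increasing_on_spins_def flip_def)
    moreover have "mean L' (m(y := 1)) ?ind = 1" "mean L' (m(y := 0)) ?ind = 0" if m: "field01 m" for m
    proof -
      have "mean L' (m(y := 1)) ?ind = mean L' (m(y := 1)) (\<lambda>_. 1)"
        using site_weight_pinned[of y "m(y := 1)" 1] L'(4) by (intro mean_cong) (auto simp: spin_configs_iff)
      then show "mean L' (m(y := 1)) ?ind = 1" using m by (subst (asm) mean_const) auto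
      have "mean L' (m(y := 0)) ?ind = mean L' (m(y := 0)) (\<lambda>_. 0)"
        using site_weight_pinned[of y "m(y := 0)" "-1"] L'(4)
        by (intro mean_cong) (force simp: spin_configs_iff)
      then show "mean L' (m(y := 0)) ?ind = 0" using m by (subst (asm) mean_const) auto
    qed
    ultimately have odds: "l y * ?Z (l0(y := 1)) / (l y * ?Z (l0(y := 1)) + (1 - l y) * ?Z (l0(y := 0)))
        \<le> l y * ?Z (l1(y := 1)) / (l y * ?Z (l1(y := 1)) + (1 - l y) * ?Z (l1(y := 0)))"
      using f ly mean_split[OF L'(4) f(1), of L' ?ind] mean_split[OF L'(4) f(2), of L' ?ind] by simp
    have pos: "0 < l y * a + (1 - l y) * b" if "0 < a" "0 < b" for a b
      using ly that by (cases "l y = 0") (auto intro!: add_pos_nonneg mult_nonneg_nonneg)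
    have "mean L l0 g \<le> mean L l1 g"
      unfolding L'(1)
      using less.prems(2) L' f ly
      apply (subst mean_bond_0[where r = r and x = y])
      apply (auto simp: l0_def)[5]
      apply (subst mean_bond_1[where r = r and x = y])
      apply (auto simp: l1_def)[5]
      unfolding ly
      by (rule add_bond_increasing) (use ly Z k_ge_1 odds u v pos in \<open>auto intro!: mult_nonneg_nonneg\<close>)
    then show ?thesis by (simp add: l1_def l0_def)
  qed
qed

end

section \<open>The influence of a pinned region on one spin\<close>

context finite_spins
begin

text \<open>Spins take the values \<open>+1\<close> and \<open>-1\<close>, so complete influence is
  \<open>2\<close> and not \<open>1\<close>.\<close>

definition influence :: "'v set multiset \<Rightarrow> ('v \<Rightarrow> real) \<Rightarrow> 'v set \<Rightarrow> 'v \<Rightarrow> real" where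
  "influence L l R u = mean L (pin R 1 l) (\<lambda>s. s u) - mean L (pin R 0 l) (\<lambda>s. s u)"

lemma field01_pin: "field01 l \<Longrightarrow> 0 \<le> c \<Longrightarrow> c \<le> 1 \<Longrightarrow> field01 (pin R c l)"
  by (auto simp: pin_def)

lemma increasing_coordinate: "u \<in> V \<Longrightarrow> increasing_on_spins V (\<lambda>s. s u)"
  by (auto simp: increasing_on_spins_def flip_def)

lemma mean_coordinate:
  assumes "x \<in> V" "field01 l"
  shows "mean L l (\<lambda>s. s x) = 2 * (l x * wsum L (l(x := 1)) (\<lambda>_. 1)
      / (l x * wsum L (l(x := 1)) (\<lambda>_. 1) + (1 - l x) * wsum L (l(x := 0)) (\<lambda>_. 1))) - 1"
proof -
  have "mean L (l(x := 1)) (\<lambda>s. s x) = 1" "mean L (l(x := 0)) (\<lambda>s. s x) = -1"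
    using assms by (auto intro!: mean_pinned)
  moreover have "0 < l x * wsum L (l(x := 1)) (\<lambda>_. 1) + (1 - l x) * wsum L (l(x := 0)) (\<lambda>_. 1)"
    using wsum_pos[OF assms(2), of L] wsum_split[OF assms(1), of L l "\<lambda>_. 1"] by simp
  ultimately show ?thesis
    using mean_split[OF assms, of L "\<lambda>s. s x"] by (simp add: field_simps)
qed

text \<open>The flip of all spins fixes the field \<open>1/2\<close> and exchanges the two pinnings
  of \<open>R\<close>.\<close>

lemma mean_half_neg:
  assumes "bonds_in V L" "u \<in> V"
  shows "mean L (pin R 0 (\<lambda>_. 1/2)) (\<lambda>s. s u) = - mean L (pin R 1 (\<lambda>_. 1/2)) (\<lambda>s. s u)"
proof -
  have "mean L (pin R 0 (\<lambda>_. 1/2)) (\<lambda>s. s u)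
      = mean L (\<lambda>x. if x \<in> V then 1 - pin R 0 (\<lambda>_. 1/2) x else pin R 0 (\<lambda>_. 1/2) x) (\<lambda>s. flip V s u)"
    using assms by (intro mean_flip) (auto simp: bonds_in_def)
  also have "\<dots> = mean L (pin R 1 (\<lambda>_. 1/2)) (\<lambda>s. flip V s u)"
    by (rule mean_cong_field) (auto simp: pin_def)
  also have "(\<lambda>s. flip V s u) = (\<lambda>s. - s u)" using assms by (auto simp: flip_def)
  finally show ?thesis by (simp add: mean_uminus)
qed

text \<open>Outside \<open>R\<close> the spin is unaffected: flipping \<open>R\<close> alone carries
  one pinning to the other.\<close>

lemma influence_no_crossing:
  assumes "R \<subseteq> V" "u \<in> V" "field01 l" "\<And>e. e \<in># L \<Longrightarrow> e \<subseteq> R \<or> e \<inter> R = {}"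
  shows "influence L l R u = (if u \<in> R then 2 else 0)"
proof (cases "u \<in> R")
  case True
  have "mean L (pin R 1 l) (\<lambda>s. s u) = 1" "mean L (pin R 0 l) (\<lambda>s. s u) = -1"
    using assms True by (auto intro!: mean_pinned simp: pin_def)
  then show ?thesis using True by (simp add: influence_def)
next
  case False
  have "mean L (pin R 1 l) (\<lambda>s. s u) = mean L (pin R 0 l) (\<lambda>s. s u)"
    using False by (subst mean_flip[where R = R, OF assms(1,4)])
      (auto simp: flip_def pin_def intro!: mean_cong_field)
  then show ?thesis using False by (simp add: influence_def)
qed

text \<open>The Ding--Song--Sun inequality. The induction adds the bonds one by one. It suffices to bound the
  influence at the value of the field at \<open>x\<close> that maximizes it: if the maximizer is \<open>0\<close> or \<open>1\<close>, then \<open>x\<close> is pinned and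
  the bond has no effect, and otherwise the maximizer is a critical point.\<close>

lemma influence_le_influence_half:
  assumes "k \<le> 2" "bonds_in V L" "R \<subseteq> V" "u \<in> V" "field01 l"
  shows "influence L l R u \<le> influence L (\<lambda>_. 1/2) R u"
  using assms(2-)
proof (induction "size L" arbitrary: L R u l rule: less_induct)
  case less
  let ?h = "\<lambda>_::'v. 1/2 :: real"
  show ?case
  proof (cases "\<forall>e\<in>#L. e \<subseteq> R \<or> e \<inter> R = {}")
    case True
    then show ?thesis using less.prems by (simp add: influence_no_crossing)
  next
    case False
    then obtain r x L' where L': "L = add_mset {r, x} L'" "r \<in> R" "x \<notin> R" "r \<in> V" "x \<in> V"
      "bonds_in V L'" "size L' < size L"
      using crossing_bond[OF less.prems(1)] by metis
    have rx: "r \<noteq> x" using L' by auto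
    have u: "u \<in> V" and R: "R \<subseteq> V" "insert x R \<subseteq> V" using less.prems L' by auto
    note IH = less.hyps[OF L'(7,6)]
    have mono: "mean L' (m(x := 0)) (\<lambda>s. s u) \<le> mean L' (m(x := 1)) (\<lambda>s. s u)" if "field01 m" for m
      using L' u that by (intro mean_increasing increasing_coordinate)
    let ?Z = "\<lambda>l. wsum L' l (\<lambda>_. 1)"
    let ?m = "\<lambda>l. mean L' l (\<lambda>s. s u)"
    \<comment> \<open>With \<open>x\<close> pinned, these partition functions and the means
      \<open>uij\<close> no longer depend on the field at \<open>x\<close>. That field enters only
      through the explicit variable \<open>t\<close> below.\<close>
    define a1 b1 a2 b2 where ab: "a1 = ?Z ((pin R 1 l)(x := 1))" "b1 = ?Z ((pin R 1 l)(x := 0))"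
      "a2 = ?Z ((pin R 0 l)(x := 1))" "b2 = ?Z ((pin R 0 l)(x := 0))"
    define u11 u10 u01 u00 where us: "u11 = ?m ((pin R 1 l)(x := 1))" "u10 = ?m ((pin R 1 l)(x := 0))"
      "u01 = ?m ((pin R 0 l)(x := 1))" "u00 = ?m ((pin R 0 l)(x := 0))"
    have fpin: "field01 (pin R 1 l)" "field01 (pin R 0 l)"
      using less.prems by (auto simp: pin_def)
    have ab_pos: "0 < a1" "0 < b1" "0 < a2" "0 < b2"
      unfolding ab using fpin by (auto intro!: wsum_pos)
    have us_mono: "u10 \<le> u11" "u00 \<le> u01" unfolding us using fpin by (auto intro!: mono)
    \<comment> \<open>Zero-field influences without the bond: in \<open>M\<close> the site
      \<open>x\<close> is forced to agree with the region, in \<open>N\<close> it is free.\<close>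
    define M where "M = influence L' ?h (insert x R) u"
    define N where "N = influence L' ?h R u"
    have pin_upd: "pin R c (l(x := t)) = (pin R c l)(x := t)" for c t l
      using L' by (auto simp: pin_def)
    have pin_insert: "pin (insert x R) c l = (pin R c l)(x := c)" for c l
      by (auto simp: pin_def)

    \<comment> \<open>These are the odds of \<open>x\<close> given root \<open>+\<close> at zero
      field without the bond, so \<open>p0\<close> is the probability of agreement. By symmetry it
      is the same for root \<open>-\<close>, which gives \<open>Ix\<close>.\<close>
    define A0 B0 where AB0: "A0 = pin R 1 ?h x * ?Z ((pin R 1 ?h)(x := 1))"
      "B0 = (1 - pin R 1 ?h x) * ?Z ((pin R 1 ?h)(x := 0))"
    define p0 where "p0 = A0 / (A0 + B0)"
    define \<alpha>0 where "\<alpha>0 = (k - 1) * p0 / (1 + (k - 1) * p0)"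
    define v1 v0 where v: "v1 = ?m ((pin R 1 ?h)(x := 1))" "v0 = ?m ((pin R 1 ?h)(x := 0))"
    have fh: "field01 ?h" "field01 (pin R 1 ?h)" by (auto simp: pin_def)
    have AB0_pos: "0 < A0" "0 < B0"
      using fh L'(3) by (auto simp: AB0 pin_def intro!: wsum_pos)
    have p0: "0 \<le> p0" using AB0_pos by (simp add: p0_def)
    have \<alpha>0: "0 \<le> \<alpha>0" using p0 k_ge_1 by (auto simp: \<alpha>0_def)
    have Ix: "influence L' ?h R x = 4 * p0 - 2"
      using mean_coordinate[OF L'(5) fh(2), of L'] mean_half_neg[OF L'(6,5), of R]
      by (simp add: influence_def AB0[symmetric] p0_def)
    have N_eq: "N = 2 * ?m (pin R 1 ?h)" and M_eq: "M = 2 * v1"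
      using mean_half_neg[OF L'(6) u, of R] mean_half_neg[OF L'(6) u, of "insert x R"]
      by (simp_all add: N_def M_def influence_def pin_insert v)
    have U: "?m (pin R 1 ?h) = (A0 * v1 + B0 * v0) / (A0 + B0)"
      using mean_split[OF L'(5) fh(2), of L' "\<lambda>s. s u"] by (simp add: AB0 v)
    have NM: "N \<le> M"
    proof -
      have "?m (pin R 1 ?h) \<le> (A0 * v1 + B0 * v1) / (A0 + B0)"
        unfolding U using AB0_pos mono[OF fh(2)]
        by (intro divide_right_mono add_mono mult_left_mono) (auto simp: v)
      also have "\<dots> = v1"
        using AB0_pos by (simp add: distrib_right[symmetric])
      finally show ?thesis by (simp add: N_eq M_eq)
    qed
    \<comment> \<open>At zero field the bound supplied by \<open>influence_step\<close> is an
      equality, so it remains to reach the same expression from above for other fields.\<close>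
    have half: "influence L ?h R u = \<alpha>0 * M + (1 - \<alpha>0) * N"
    proof -
      have "mean L (pin R 1 ?h) (\<lambda>s. s u) = (k * A0 * v1 + B0 * v0) / (k * A0 + B0)"
        unfolding L'(1) using mean_bond_1[OF L'(4,5) rx _ fh(2), of L' "\<lambda>s. s u"] L'(2)
        by (simp add: AB0 v pin_def)
      also have "\<dots> = \<alpha>0 * v1 + (1 - \<alpha>0) * ?m (pin R 1 ?h)"
        by (rule mean_bond_algebra[OF AB0_pos k_ge_1 p0_def \<alpha>0_def U])
      finally show ?thesis
        using mean_half_neg[OF less.prems(1) u, of R] by (simp add: influence_def M_eq N_eq algebra_simps)
    qed
    have N_half: "N \<le> influence L ?h R u"
      unfolding half using mult_nonneg_nonneg[OF \<alpha>0, of "M - N"] NM by (simp add: algebra_simps)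

    \<comment> \<open>The influence in the system with the bond, as a function of the field
      \<open>t\<close> at \<open>x\<close>, all other fields being fixed.\<close>
    define f1 f2 f where f: "f1 = (\<lambda>t. (k * (t * a1) * u11 + (1 - t) * b1 * u10) / (k * (t * a1) + (1 - t) * b1))"
      "f2 = (\<lambda>t. (t * a2 * u01 + k * ((1 - t) * b2) * u00) / (t * a2 + k * ((1 - t) * b2)))"
      "f = (\<lambda>t. f1 t - f2 t)"
    have f_eq: "influence L (l(x := t)) R u = f t" if "0 \<le> t" "t \<le> 1" for t
    proof -
      have fp: "field01 ((pin R c l)(x := t))" if "c = 0 \<or> c = 1" for c
        using fpin \<open>0 \<le> t\<close> \<open>t \<le> 1\<close> that by auto
      have "mean L (pin R 1 (l(x := t))) (\<lambda>s. s u) = f1 t"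
        unfolding L'(1) pin_upd using L' fp
        by (subst mean_bond_1[OF L'(4,5) rx]) (auto simp: pin_def f ab us)
      moreover have "mean L (pin R 0 (l(x := t))) (\<lambda>s. s u) = f2 t"
        unfolding L'(1) pin_upd using L' fp
        by (subst mean_bond_0[OF L'(4,5) rx]) (auto simp: pin_def f ab us)
      ultimately show ?thesis by (simp add: influence_def f)
    qed
    have pos: "0 < t * a + (1 - t) * b" if "0 \<le> t" "t \<le> 1" "0 < a" "0 < b" for t a b :: real
      using that by (cases "t = 0") (auto intro!: add_pos_nonneg mult_nonneg_nonneg)
    have den: "0 < k * (t * a1) + (1 - t) * b1" "0 < t * a2 + k * ((1 - t) * b2)" if "0 \<le> t" "t \<le> 1" for t
      using pos[OF that, of "k * a1" b1] pos[OF that, of a2 "k * b2"] k_ge_1 ab_pos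
      by (simp_all add: algebra_simps)
    have "continuous_on {0..1} f"
      unfolding f using den by (intro continuous_intros) force+
    then obtain t where t: "0 \<le> t" "t \<le> 1" and max: "\<And>s. 0 \<le> s \<Longrightarrow> s \<le> 1 \<Longrightarrow> f s \<le> f t"
      using continuous_attains_sup[of "{0..1::real}" f] by auto
    have "f t \<le> influence L ?h R u"
    proof -
      consider "t = 0" | "t = 1" | "0 < t" "t < 1" using t by linarith
      then show ?thesis
      proof cases
        case 1
        then have "f t = influence L' (l(x := 0)) R u"
          using ab_pos k_ge_1 by (simp add: f influence_def pin_upd us)
        also have "\<dots> \<le> N" unfolding N_def using less.prems by (intro IH) auto
        finally show ?thesis using N_half by simp
      next
        case 2
        then have "f t = influence L' (l(x := 1)) R u"
          using ab_pos k_ge_1 by (simp add: f influence_def pin_upd us)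
        also have "\<dots> \<le> N" unfolding N_def using less.prems by (intro IH) auto
        finally show ?thesis using N_half by simp
      next
        case 3
        define D1 where "D1 = k * (t * a1) + (1 - t) * b1"
        define D2 where "D2 = t * a2 + k * ((1 - t) * b2)"
        have D: "D1 \<noteq> 0" "D2 \<noteq> 0" using den[OF t] by (auto simp: D1_def D2_def)
        have d1: "(f1 has_real_derivative k * a1 * b1 * (u11 - u10) / D1\<^sup>2) (at t)"
          unfolding f(1)
          by (rule derivative_eq_intros refl | use D in \<open>simp add: D1_def; fail\<close>)+
             (simp add: D1_def[symmetric] power2_eq_square, simp add: D1_def algebra_simps)
        have d2: "(f2 has_real_derivative k * a2 * b2 * (u01 - u00) / D2\<^sup>2) (at t)"
          unfolding f(2)
          by (rule derivative_eq_intros refl | use D in \<open>simp add: D2_def; fail\<close>)+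
             (simp add: D2_def[symmetric] power2_eq_square, simp add: D2_def algebra_simps)
        have "(f has_real_derivative k * a1 * b1 * (u11 - u10) / D1\<^sup>2 - k * a2 * b2 * (u01 - u00) / D2\<^sup>2) (at t)"
          unfolding f(3) by (intro derivative_intros d1 d2)
        moreover have "0 < min t (1 - t)" using 3 by simp
        moreover have "\<forall>s. \<bar>t - s\<bar> < min t (1 - t) \<longrightarrow> f s \<le> f t" using max by auto
        ultimately have "k * a1 * b1 * (u11 - u10) / D1\<^sup>2 - k * a2 * b2 * (u01 - u00) / D2\<^sup>2 = 0"
          by (rule DERIV_local_max)
        then have "k * (a1 * b1 * (u11 - u10) / D1\<^sup>2) = k * (a2 * b2 * (u01 - u00) / D2\<^sup>2)"
          by (simp add: mult.assoc)
        then have "a1 * b1 * (u11 - u10) / D1\<^sup>2 = a2 * b2 * (u01 - u00) / D2\<^sup>2"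
          using k_ge_1 by (subst (asm) mult_cancel_left) auto
        \<comment> \<open>The factor \<open>t * (1 - t)\<close> turns the vanishing derivative into
          the stationarity condition for the odds \<open>t * a1 : (1 - t) * b1\<close> and
          \<open>t * a2 : (1 - t) * b2\<close>.\<close>
        then have "(t * (1 - t)) * (a1 * b1 * (u11 - u10) / D1\<^sup>2) = (t * (1 - t)) * (a2 * b2 * (u01 - u00) / D2\<^sup>2)"
          by simp
        then have stat: "(t * a1) * ((1 - t) * b1) * (u11 - u10) / (k * (t * a1) + (1 - t) * b1)\<^sup>2
            = (t * a2) * ((1 - t) * b2) * (u01 - u00) / (t * a2 + k * ((1 - t) * b2))\<^sup>2"
          by (simp add: D1_def D2_def mult_ac)
        have ft: "field01 (l(x := t))" using less.prems t by auto
        have fpt: "field01 (pin R 1 (l(x := t)))" "field01 (pin R 0 (l(x := t)))"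
          by (rule field01_pin[OF ft]; simp)+
        have split: "mean L' (pin R 1 (l(x := t))) (\<lambda>s. s w) =
           (t * a1 * mean L' ((pin R 1 l)(x := 1)) (\<lambda>s. s w) + (1 - t) * b1 * mean L' ((pin R 1 l)(x := 0)) (\<lambda>s. s w))
             / (t * a1 + (1 - t) * b1)"
          "mean L' (pin R 0 (l(x := t))) (\<lambda>s. s w) =
           (t * a2 * mean L' ((pin R 0 l)(x := 1)) (\<lambda>s. s w) + (1 - t) * b2 * mean L' ((pin R 0 l)(x := 0)) (\<lambda>s. s w))
             / (t * a2 + (1 - t) * b2)" for w
          using mean_split[of x "pin R 1 (l(x := t))" L' "\<lambda>s. s w", OF L'(5) fpt(1)]
            mean_split[of x "pin R 0 (l(x := t))" L' "\<lambda>s. s w", OF L'(5) fpt(2)]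
          by (simp_all add: pin_upd ab)
        \<comment> \<open>Three uses of the induction hypothesis: for the target \<open>u\<close>
          with \<open>x\<close> free, for \<open>u\<close> with \<open>x\<close> joined to the
          region, and for \<open>x\<close> itself as target. They supply the bounds by
          \<open>N\<close>, \<open>M\<close> and \<open>p0\<close>.\<close>
        have *: "influence L' (l(x := t)) R u \<le> N"
          unfolding N_def using less.prems ft by (intro IH) auto
        have **: "influence L' l (insert x R) u \<le> M"
          unfolding M_def using less.prems R by (intro IH) auto
        have ***: "influence L' (l(x := t)) R x \<le> influence L' ?h R x"
          using less.prems ft L' by (intro IH) auto
        have px: "influence L' (l(x := t)) R x =
            2 * (t * a1 / (t * a1 + (1 - t) * b1)) - 2 * (t * a2 / (t * a2 + (1 - t) * b2))"
          using mean_coordinate[of x "pin R 1 (l(x := t))" L', OF L'(5) fpt(1)] mean_coordinate[of x "pin R 0 (l(x := t))" L', OF L'(5) fpt(2)]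
          by (simp add: influence_def pin_upd ab)
        have q: "t * a2 / (t * a2 + (1 - t) * b2) = 1 - (1 - t) * b2 / (t * a2 + (1 - t) * b2)"
          using pos[OF t ab_pos(3,4)] by (simp add: field_simps)
        have "f t \<le> \<alpha>0 * M + (1 - \<alpha>0) * N"
          unfolding f
        proof (rule influence_step[OF _ _ _ _ k_ge_1 assms(1) us_mono stat _ _ NM _ \<alpha>0_def])
          show "0 < t * a1" "0 < (1 - t) * b1" "0 < t * a2" "0 < (1 - t) * b2"
            using 3 ab_pos by auto
          show "(t * a1 * u11 + (1 - t) * b1 * u10) / (t * a1 + (1 - t) * b1)
              - (t * a2 * u01 + (1 - t) * b2 * u00) / (t * a2 + (1 - t) * b2) \<le> N"
            using * by (simp add: influence_def split us)
          show "u11 - u00 \<le> M" using ** by (simp add: influence_def pin_insert us)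
          show "t * a1 / (t * a1 + (1 - t) * b1) + (1 - t) * b2 / (t * a2 + (1 - t) * b2) \<le> 2 * p0"
            using *** unfolding px q Ix by simp
        qed
        then show ?thesis by (simp add: half)
      qed
    qed
    moreover have "influence L l R u = f (l x)"
      using f_eq[of "l x"] less.prems(4) L'(5) by simp
    moreover have "f (l x) \<le> f t" using max less.prems(4) L'(5) by blast
    ultimately show ?thesis by simp
  qed
qed

end

section \<open>Averaged conditional expectations\<close>

text \<open>The ratios of consecutive terms of a log-convex sequence do not decrease. A first ratio
  \<open>\<theta>\<close> above \<open>r\<close> would force growth at least like
  \<open>\<theta> ^ m\<close>, against the bound.\<close>

lemma log_convex_growth:
  fixes x :: "nat \<Rightarrow> real"
  assumes nonneg: "\<And>m. 0 \<le> x m" and convex: "\<And>m. (x (Suc m))\<^sup>2 \<le> x m * x (Suc (Suc m))"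
    and bound: "\<And>m. x m \<le> C * r ^ m" and r: "0 \<le> r"
  shows "x 1 \<le> r * x 0"
proof (rule ccontr)
  assume "\<not> x 1 \<le> r * x 0"
  then have *: "r * x 0 < x 1" by simp
  then have x1: "0 < x 1" using nonneg[of 0] r mult_nonneg_nonneg[of r "x 0"] by linarith
  have x0: "0 < x 0"
  proof (rule ccontr)
    assume "\<not> 0 < x 0"
    then have "x 0 = 0" using nonneg[of 0] by simp
    then show False using convex[of 0] x1 by simp
  qed
  define \<theta> where "\<theta> = x 1 / x 0"
  have \<theta>: "r < \<theta>" using * x0 by (simp add: \<theta>_def field_simps)
  have step: "0 < x m \<and> \<theta> * x m \<le> x (Suc m)" for m
  proof (induction m)
    case 0
    then show ?case using x0 by (simp add: \<theta>_def)
  next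
    case (Suc m)
    then have m: "0 < x m" and le: "\<theta> * x m \<le> x (Suc m)" by auto
    have Sm: "0 < x (Suc m)" using m le \<theta> r mult_pos_pos[of \<theta> "x m"] by linarith
    have "\<theta> * x m * x (Suc m) \<le> x (Suc m) * x (Suc m)"
      using le Sm by (intro mult_right_mono) auto
    also have "\<dots> \<le> x m * x (Suc (Suc m))" using convex[of m] by (simp add: power2_eq_square)
    finally have "x m * (\<theta> * x (Suc m)) \<le> x m * x (Suc (Suc m))" by (simp add: mult_ac)
    then show ?case using m Sm by simp
  qed
  have lower: "\<theta> ^ m * x 0 \<le> x m" for m
  proof (induction m)
    case (Suc m)
    have "\<theta> * (\<theta> ^ m * x 0) \<le> \<theta> * x m" using Suc \<theta> r by (intro mult_left_mono) auto
    then show ?case using step[of m] by (simp add: mult.assoc)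
  qed simp
  show False
  proof (cases "r = 0")
    case True
    then show False using bound[of 1] x1 by simp
  next
    case False
    then have "0 < r" using r by simp
    then have "1 < \<theta> / r" using \<theta> by simp
    then obtain n where "C / x 0 < (\<theta> / r) ^ n" using real_arch_pow by blast
    then have "C * r ^ n < \<theta> ^ n * x 0" using \<open>0 < r\<close> x0 by (simp add: power_divide field_simps)
    then show False using lower[of n] bound[of n] by linarith
  qed
qed

lemma sum_weighted_Cauchy_Schwarz:
  fixes w f g :: "'a \<Rightarrow> real"
  assumes "\<And>s. s \<in> A \<Longrightarrow> 0 \<le> w s"
  shows "(\<Sum>s\<in>A. w s * (f s * g s))\<^sup>2 \<le> (\<Sum>s\<in>A. w s * (f s)\<^sup>2) * (\<Sum>s\<in>A. w s * (g s)\<^sup>2)"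
proof -
  have "(\<Sum>s\<in>A. (sqrt (w s) * f s) * (sqrt (w s) * g s))\<^sup>2
      \<le> (\<Sum>s\<in>A. (sqrt (w s) * f s)\<^sup>2) * (\<Sum>s\<in>A. (sqrt (w s) * g s)\<^sup>2)"
    by (rule Cauchy_Schwarz_ineq_sum)
  moreover have "(sqrt (w s) * f s) * (sqrt (w s) * g s) = w s * (f s * g s)" if "s \<in> A" for s
    using assms[OF that] by (simp add: mult_ac)
  moreover have "(sqrt (w s) * h s)\<^sup>2 = w s * (h s)\<^sup>2" if "s \<in> A" for s and h :: "'a \<Rightarrow> real"
    using assms[OF that] by (simp add: power_mult_distrib)
  ultimately show ?thesis by simp
qed

text \<open>By Cauchy--Schwarz the sequence of the squared norms of \<open>T\<^sup>m f\<close> is log-convex, so its first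
  ratio is at most its growth rate.\<close>

lemma self_adjoint_form_le_growth:
  fixes w :: "'a \<Rightarrow> real" and T :: "('a \<Rightarrow> real) \<Rightarrow> 'a \<Rightarrow> real"
  assumes w: "\<And>s. s \<in> A \<Longrightarrow> 0 \<le> w s"
    and sym: "\<And>f g. (\<Sum>s\<in>A. w s * (T f s * g s)) = (\<Sum>s\<in>A. w s * (f s * T g s))"
    and growth: "\<And>m. (\<Sum>s\<in>A. w s * ((T ^^ m) f s)\<^sup>2) \<le> C * (r ^ m)\<^sup>2" and r: "0 \<le> r"
  shows "(\<Sum>s\<in>A. w s * (f s * T f s)) \<le> r * (\<Sum>s\<in>A. w s * (f s)\<^sup>2)"
proof -
  define x where "x = (\<lambda>m. \<Sum>s\<in>A. w s * ((T ^^ m) f s)\<^sup>2)"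
  have nonneg: "0 \<le> x m" for m unfolding x_def by (intro sum_nonneg mult_nonneg_nonneg w) auto
  have "x 1 \<le> r\<^sup>2 * x 0"
  proof (rule log_convex_growth)
    show "0 \<le> x m" for m by (rule nonneg)
    show "(x (Suc m))\<^sup>2 \<le> x m * x (Suc (Suc m))" for m
    proof -
      have "x (Suc m) = (\<Sum>s\<in>A. w s * (T ((T ^^ m) f) s * (T ^^ Suc m) f s))"
        by (simp add: x_def power2_eq_square)
      also have "\<dots> = (\<Sum>s\<in>A. w s * ((T ^^ m) f s * (T ^^ Suc (Suc m)) f s))"
        unfolding sym by simp
      finally show ?thesis
        unfolding x_def using sum_weighted_Cauchy_Schwarz[where A = A and w = w, OF w] by simp
    qed
    show "x m \<le> C * (r\<^sup>2) ^ m" for m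
      using growth[of m] by (simp add: x_def power_mult[symmetric] mult.commute)
  qed simp
  \<comment> \<open>A bound on the norm of \<open>T f\<close> relative to \<open>f\<close> bounds
    the quadratic form, again by Cauchy--Schwarz.\<close>
  have "(\<Sum>s\<in>A. w s * (f s * T f s))\<^sup>2 \<le> x 0 * x 1"
    using sum_weighted_Cauchy_Schwarz[where A = A and w = w and f = f and g = "T f", OF w] by (simp add: x_def)
  also have "\<dots> \<le> x 0 * (r\<^sup>2 * x 0)" using \<open>x 1 \<le> r\<^sup>2 * x 0\<close> nonneg by (intro mult_left_mono)
  also have "\<dots> = (r * x 0)\<^sup>2" by (simp add: power2_eq_square)
  finally have "(\<Sum>s\<in>A. w s * (f s * T f s)) \<le> r * x 0"
    by (rule power2_le_imp_le) (simp add: r nonneg)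
  then show ?thesis by (simp add: x_def)
qed

text \<open>The conditional expectation given \<open>\<pi>\<close> on a finite space, for weights
  that need not be normalised.\<close>

definition class_mean :: "'a set \<Rightarrow> ('a \<Rightarrow> real) \<Rightarrow> ('a \<Rightarrow> 'b) \<Rightarrow> ('a \<Rightarrow> real) \<Rightarrow> 'a \<Rightarrow> real" where
  "class_mean A w \<pi> f s =
     (\<Sum>t\<in>{t\<in>A. \<pi> t = \<pi> s}. w t * f t) / (\<Sum>t\<in>{t\<in>A. \<pi> t = \<pi> s}. w t)"

lemma class_mean_cong: "\<pi> s = \<pi> t \<Longrightarrow> class_mean A w \<pi> f s = class_mean A w \<pi> f t"
  by (simp add: class_mean_def)

text \<open>The defining property of conditional expectation. On each class the test function
  \<open>F\<close> is constant and comes out of the sum.\<close>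

lemma sum_class_mean:
  assumes fin: "finite A" and w: "\<And>s. s \<in> A \<Longrightarrow> 0 < w s"
    and F: "\<And>s t. s \<in> A \<Longrightarrow> t \<in> A \<Longrightarrow> \<pi> s = \<pi> t \<Longrightarrow> F s = F t"
  shows "(\<Sum>s\<in>A. w s * (class_mean A w \<pi> f s * F s)) = (\<Sum>s\<in>A. w s * (f s * F s))"
proof -
  have block: "(\<Sum>s\<in>{s\<in>A. \<pi> s = c}. w s * (class_mean A w \<pi> f s * F s))
      = (\<Sum>s\<in>{s\<in>A. \<pi> s = c}. w s * (f s * F s))" if c: "c \<in> \<pi> ` A" for c
  proof -
    obtain a where a: "a \<in> A" "\<pi> a = c" using c by auto
    let ?B = "{s\<in>A. \<pi> s = c}"
    have Fa: "F s = F a" if "s \<in> ?B" for s using F[of s a] a that by simp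
    have W: "0 < sum w ?B" using a w fin by (intro sum_pos) auto
    have "(\<Sum>s\<in>?B. w s * (class_mean A w \<pi> f s * F s))
        = (\<Sum>s\<in>?B. w s * ((\<Sum>t\<in>?B. w t * f t) / sum w ?B * F a))"
      using Fa by (intro sum.cong) (auto simp: class_mean_def)
    also have "\<dots> = sum w ?B * ((\<Sum>t\<in>?B. w t * f t) / sum w ?B * F a)"
      by (rule sum_distrib_right[symmetric])
    also have "\<dots> = (\<Sum>t\<in>?B. w t * f t) * F a" using W by simp
    also have "\<dots> = (\<Sum>s\<in>?B. w s * (f s * F s))"
      unfolding sum_distrib_right using Fa by (intro sum.cong) auto
    finally show ?thesis .
  qed
  have "(\<Sum>s\<in>A. w s * (class_mean A w \<pi> f s * F s))
      = (\<Sum>c\<in>\<pi> ` A. \<Sum>s\<in>{s\<in>A. \<pi> s = c}. w s * (class_mean A w \<pi> f s * F s))"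
    using fin by (rule sum.image_gen)
  also have "\<dots> = (\<Sum>c\<in>\<pi> ` A. \<Sum>s\<in>{s\<in>A. \<pi> s = c}. w s * (f s * F s))"
    by (rule sum.cong[OF refl block])
  also have "\<dots> = (\<Sum>s\<in>A. w s * (f s * F s))"
    using fin by (rule sum.image_gen[symmetric])
  finally show ?thesis .
qed

text \<open>The right-hand side is symmetric in \<open>f\<close> and \<open>g\<close>, so the
  operator is self-adjoint; with \<open>g = f\<close> its quadratic form is the squared norm of the
  conditional expectation.\<close>

lemma sum_class_mean_mult:
  assumes "finite A" "\<And>s. s \<in> A \<Longrightarrow> 0 < w s"
  shows "(\<Sum>s\<in>A. w s * (class_mean A w \<pi> f s * g s))
    = (\<Sum>s\<in>A. w s * (class_mean A w \<pi> f s * class_mean A w \<pi> g s))"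
proof -
  have "(\<Sum>s\<in>A. w s * (class_mean A w \<pi> g s * class_mean A w \<pi> f s))
      = (\<Sum>s\<in>A. w s * (g s * class_mean A w \<pi> f s))"
    by (rule sum_class_mean[OF assms class_mean_cong])
  then show ?thesis by (simp add: mult.commute)
qed

section \<open>Contraction of oscillations by averaged conditional expectations\<close>

locale bond_spins = finite_spins +
  fixes L :: "'a set multiset"
  assumes bonds: "bonds_in V L" and k_le_2: "k \<le> 2"
begin

abbreviation half :: "'a \<Rightarrow> real" where "half \<equiv> (\<lambda>_. 1/2)"

definition corr :: "'a \<Rightarrow> 'a \<Rightarrow> real" where
  "corr v u = mean L half (\<lambda>s. s v * s u)"

lemma mean_add: "mean M l (\<lambda>s. f s + g s) = mean M l f + mean M l g"
  by (simp add: mean_def wsum_def distrib_left sum.distrib add_divide_distrib)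

lemma mean_cmult: "mean M l (\<lambda>s. c * f s) = c * mean M l f"
  by (simp add: mean_def wsum_def sum_distrib_left mult_ac)

lemma mean_sum: "finite A \<Longrightarrow> mean M l (\<lambda>s. \<Sum>a\<in>A. f a s) = (\<Sum>a\<in>A. mean M l (f a))"
proof (induction A rule: finite_induct)
  case empty
  then show ?case by (simp add: mean_def wsum_def)
qed (simp add: mean_add)

text \<open>By the global flip, the two values of the spin at \<open>v\<close> contribute equally to
  the two-point function.\<close>

lemma corr_eq:
  assumes "v \<in> V" "u \<in> V"
  shows "corr v u = mean L (half(v := 1)) (\<lambda>s. s u)"
proof -
  have f: "field01 half" by simp
  have 1: "mean L (half(v := 1)) (\<lambda>s. s v * s u) = mean L (half(v := 1)) (\<lambda>s. s u)"
    using site_weight_pinned[of v "half(v := 1)" 1] assms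
    by (intro mean_cong) (auto simp: spin_configs_iff)
  have "mean L (half(v := 0)) (\<lambda>s. s v * s u) = mean L (half(v := 0)) (\<lambda>s. - s u)"
  proof (rule mean_cong)
    fix s assume "s \<in> \<Omega>" "site_weight V (half(v := 0)) s \<noteq> 0"
    then have "s v = -1"
      using site_weight_pinned[of v "half(v := 0)" "-1"] assms by (simp add: spin_configs_iff)
    then show "s v * s u = - s u" by simp
  qed
  also have "\<dots> = mean L (half(v := 1)) (\<lambda>s. s u)"
  proof -
    have "pin {v} c half = half(v := c)" for c by (auto simp: pin_def)
    then show ?thesis using mean_half_neg[OF bonds assms(2), of "{v}"] by (simp add: mean_uminus)
  qed
  finally have 0: "mean L (half(v := 0)) (\<lambda>s. s v * s u) = mean L (half(v := 1)) (\<lambda>s. s u)" .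
  have pos: "0 < wsum L (half(v := 1)) (\<lambda>_. 1)" "0 < wsum L (half(v := 0)) (\<lambda>_. 1)"
    by (auto intro!: wsum_pos)
  have "(1/2 * a * m + (1 - 1/2) * b * m) / (1/2 * a + (1 - 1/2) * b) = m" if "0 < a" "0 < b" for a b m :: real
    using that by (simp add: distrib_right[symmetric] add_divide_distrib[symmetric])
  then show ?thesis
    unfolding corr_def mean_split[OF assms(1) f, of L "\<lambda>s. s v * s u"] 0 1 using pos by blast
qed

lemma influence_le_corr:
  assumes "v \<in> V" "u \<in> V" "field01 l"
  shows "mean L (l(v := 1)) (\<lambda>s. s u) - mean L (l(v := 0)) (\<lambda>s. s u) \<le> 2 * corr v u"
proof -
  have "pin {v} c l = l(v := c)" for c l by (auto simp: pin_def)
  then show ?thesis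
    using influence_le_influence_half[OF k_le_2 bonds _ assms(2,3), of "{v}"]
      mean_half_neg[OF bonds assms(2), of "{v}"] corr_eq[OF assms(1,2)] assms(1)
    by (simp add: influence_def)
qed

text \<open>Since \<open>\<plusminus> f\<close> becomes increasing after adding \<open>\<Sum>\<^sub>u o\<^sub>u s\<^sub>u / 2\<close>, no coupling of the two
  pinned measures is needed.\<close>

lemma mean_pinned_diff_le:
  assumes "v \<in> V" "field01 l"
    and osc: "\<And>s u. s \<in> \<Omega> \<Longrightarrow> u \<in> V \<Longrightarrow> \<bar>f (flip {u} s) - f s\<bar> \<le> osc u"
  shows "\<bar>mean L (l(v := 1)) f - mean L (l(v := 0)) f\<bar> \<le> (\<Sum>u\<in>V. osc u * corr v u)"
proof -
  have ne: "\<Omega> \<noteq> {}" by (auto simp: spin_configs_def PiE_eq_empty_iff)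
  have osc0: "0 \<le> osc u" if "u \<in> V" for u
    using osc[OF _ that] ne by (meson abs_ge_zero ex_in_conv order_trans)
  have key: "c * (mean L (l(v := 0)) f - mean L (l(v := 1)) f) \<le> (\<Sum>u\<in>V. osc u * corr v u)"
    if c: "c = 1 \<or> c = -1" for c
  proof -
    \<comment> \<open>An upward flip at \<open>u\<close> raises the spin by \<open>2\<close>, so the
      coefficient \<open>osc u / 2\<close> gains exactly \<open>osc u\<close>, enough to absorb any
      decrease of \<open>c * f\<close>.\<close>
    let ?G = "\<lambda>s. (\<Sum>u\<in>V. osc u / 2 * s u) + c * f s"
    have "increasing_on_spins V ?G"
      unfolding increasing_on_spins_def
    proof (intro ballI impI)
      fix s x assume s: "s \<in> \<Omega>" "x \<in> V" "s x = -1"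
      have "(\<Sum>u\<in>V. osc u / 2 * flip {x} s u) = (\<Sum>u\<in>V. osc u / 2 * s u) + osc x"
      proof -
        have "(\<Sum>u\<in>V. osc u / 2 * flip {x} s u) - (\<Sum>u\<in>V. osc u / 2 * s u)
            = (\<Sum>u\<in>V. if u = x then osc x else 0)"
          unfolding sum_subtractf[symmetric] by (intro sum.cong) (auto simp: flip_def s)
        also have "\<dots> = osc x" using s finite_V by simp
        finally show ?thesis by simp
      qed
      moreover have "- osc x \<le> c * f (flip {x} s) - c * f s"
        using osc[OF s(1,2)] c by (auto simp: abs_le_iff)
      ultimately show "?G s \<le> ?G (flip {x} s)" by simp
    qed
    moreover have lin: "mean L m ?G = (\<Sum>u\<in>V. osc u / 2 * mean L m (\<lambda>s. s u)) + c * mean L m f" for m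
      unfolding mean_add mean_sum[OF finite_V] mean_cmult ..
    ultimately have "mean L (l(v := 0)) ?G \<le> mean L (l(v := 1)) ?G"
      using assms(1,2) bonds by (intro mean_increasing)
    then have "c * (mean L (l(v := 0)) f - mean L (l(v := 1)) f)
        \<le> (\<Sum>u\<in>V. osc u / 2 * (mean L (l(v := 1)) (\<lambda>s. s u) - mean L (l(v := 0)) (\<lambda>s. s u)))"
      unfolding lin by (simp add: right_diff_distrib sum_subtractf)
    also have "\<dots> \<le> (\<Sum>u\<in>V. osc u / 2 * (2 * corr v u))"
      using influence_le_corr[OF assms(1) _ assms(2)] osc0 by (intro sum_mono mult_left_mono) auto
    finally show ?thesis by simp
  qed
  show ?thesis
    using key[OF disjI1[OF refl]] key[OF disjI2[OF refl]] by (simp add: abs_le_iff)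
qed

end

lemma spin_neq:
  assumes "s \<in> spin_configs V" "t \<in> spin_configs V" "x \<in> V" "t x \<noteq> s x"
  shows "t x = - s x"
proof -
  have "s x = 1 \<or> s x = -1" "t x = 1 \<or> t x = -1" using assms by (simp_all add: spin_configs_iff)
  then show ?thesis using assms(4) by auto
qed

context bond_spins
begin

abbreviation (input) w where "w \<equiv> bond_weight k L"

definition cond :: "'a set \<Rightarrow> (('a \<Rightarrow> real) \<Rightarrow> real) \<Rightarrow> ('a \<Rightarrow> real) \<Rightarrow> real" where
  "cond U = class_mean \<Omega> w (\<lambda>t. restrict t U)"

lemma w_pos: "0 < w s"
  using bond_weight_ge_1[of L s] by linarith

text \<open>Pinning \<open>U\<close> to the values of \<open>s\<close> is, up to a constant, the
  indicator of the configurations that look like \<open>s\<close> on \<open>U\<close>. This turns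
  conditional expectations into means with pinned sites, where the influence inequality
  applies.\<close>

lemma site_weight_observed:
  assumes "U \<subseteq> V" "s \<in> \<Omega>" "t \<in> \<Omega>"
  shows "site_weight V (\<lambda>y. if y \<in> U then (1 + s y) / 2 else 1/2) t
    = (if restrict t U = restrict s U then (1/2) ^ card (V - U) else 0)"
proof (cases "restrict t U = restrict s U")
  case True
  then have eq: "t y = s y" if "y \<in> U" for y using that by (metis restrict_apply')
  have "site_weight V (\<lambda>y. if y \<in> U then (1 + s y) / 2 else 1/2) t = (\<Prod>y\<in>V. if y \<in> U then 1 else 1/2)"
    unfolding site_weight_def using assms by (intro prod.cong) (auto simp: eq spin_configs_iff)
  also have "\<dots> = (1/2) ^ card (V - U)"
    using prod.inter_restrict[OF finite_V, of "\<lambda>_. 1/2::real" "- U"]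
    by (simp add: Diff_eq if_not_P if_distrib cong: if_cong) (rule prod.cong, auto)
  finally show ?thesis using True by simp
next
  case False
  then obtain y where y: "y \<in> U" "t y \<noteq> s y" by (metis restrict_ext)
  then have "y \<in> V" using assms by auto
  moreover from this have "t y = - s y" "s y = 1 \<or> s y = -1"
    using y assms(2,3) spin_neq[of s V t y] by (auto simp: spin_configs_iff)
  ultimately have "site_weight V (\<lambda>y. if y \<in> U then (1 + s y) / 2 else 1/2) t = 0"
    unfolding site_weight_def using finite_V y by (intro prod_zero bexI[of _ y]) auto
  then show ?thesis using False by simp
qed

lemma cond_eq_mean:
  assumes "U \<subseteq> V" "s \<in> \<Omega>"
  shows "cond U f s = mean L (\<lambda>y. if y \<in> U then (1 + s y) / 2 else 1/2) f"
proof -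
  let ?B = "{t\<in>\<Omega>. restrict t U = restrict s U}"
  have "wsum L (\<lambda>y. if y \<in> U then (1 + s y) / 2 else 1/2) g = (1/2) ^ card (V - U) * (\<Sum>t\<in>?B. w t * g t)" for g
  proof -
    have "wsum L (\<lambda>y. if y \<in> U then (1 + s y) / 2 else 1/2) g
        = (\<Sum>t\<in>\<Omega>. if restrict t U = restrict s U then (1/2) ^ card (V - U) * (w t * g t) else 0)"
      unfolding wsum_def by (intro sum.cong) (simp_all add: site_weight_observed assms)
    also have "\<dots> = (\<Sum>t\<in>?B. (1/2) ^ card (V - U) * (w t * g t))"
      by (rule sum.inter_filter[OF finite_\<Omega>, symmetric])
    finally show ?thesis by (simp add: sum_distrib_left)
  qed
  then show ?thesis by (simp add: mean_def cond_def class_mean_def)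
qed

lemma mean_half: "mean L half f = (\<Sum>s\<in>\<Omega>. w s * f s) / (\<Sum>s\<in>\<Omega>. w s)"
proof -
  have "site_weight V half s = (1/2) ^ card V" for s
    unfolding site_weight_def by (simp add: if_distrib cong: if_cong)
  then show ?thesis by (simp add: mean_def wsum_def sum_distrib_left[symmetric] mult.assoc)
qed

text \<open>A spin outside \<open>U\<close> is not observed. Flipping \<open>v\<close> in
  \<open>U\<close> exchanges the two pinnings of \<open>v\<close> while the rest of \<open>U\<close>
  stays pinned, and the influence bound is uniform over such pinnings.\<close>

lemma cond_osc:
  assumes U: "U \<subseteq> V" and s: "s \<in> \<Omega>" and v: "v \<in> V"
    and osc: "\<And>s u. s \<in> \<Omega> \<Longrightarrow> u \<in> V \<Longrightarrow> \<bar>f (flip {u} s) - f s\<bar> \<le> c"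
    and K: "(\<Sum>u\<in>V. corr v u) \<le> K"
  shows "\<bar>cond U f (flip {v} s) - cond U f s\<bar> \<le> (if v \<in> U then K * c else 0)"
proof -
  define l where "l = (\<lambda>y. if y \<in> U then (1 + s y) / 2 else 1/2)"
  have sv: "flip {v} s \<in> \<Omega>" using v s by (intro flip_in_spin_configs) auto
  have "\<bar>f (flip {v} s) - f s\<bar> \<le> c" by (rule osc[OF s v])
  then have c: "0 \<le> c" by linarith
  show ?thesis
  proof (cases "v \<in> U")
    case False
    then have "restrict (flip {v} s) U = restrict s U" by (auto simp: flip_def)
    then show ?thesis using False by (simp add: cond_def class_mean_def)
  next
    case True
    have l: "field01 l" using s U by (auto simp: l_def spin_configs_iff)
    have sgn: "s v = 1 \<or> s v = -1" using s v by (auto simp: spin_configs_iff)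
    have "cond U f s = mean L (l(v := (1 + s v) / 2)) f"
      unfolding cond_eq_mean[OF U s] by (rule mean_cong_field) (use True in \<open>auto simp: l_def\<close>)
    moreover have "cond U f (flip {v} s) = mean L (l(v := (1 - s v) / 2)) f"
      unfolding cond_eq_mean[OF U sv] by (rule mean_cong_field) (use True in \<open>auto simp: l_def flip_def\<close>)
    moreover have "\<bar>mean L (l(v := 1)) f - mean L (l(v := 0)) f\<bar> \<le> (\<Sum>u\<in>V. c * corr v u)"
      by (rule mean_pinned_diff_le[OF v l osc])
    moreover have "(\<Sum>u\<in>V. c * corr v u) \<le> K * c"
      using mult_left_mono[OF K c] by (simp add: sum_distrib_left mult.commute)
    ultimately show ?thesis using True sgn by (auto simp: abs_minus_commute)
  qed
qed

text \<open>Telescopes over the sites where \<open>s\<close> and \<open>t\<close> differ, flipping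
  them one at a time.\<close>

lemma diff_le_card_osc:
  assumes osc: "\<And>s u. s \<in> \<Omega> \<Longrightarrow> u \<in> V \<Longrightarrow> \<bar>g (flip {u} s) - g s\<bar> \<le> c"
    and s: "s \<in> \<Omega>" and t: "t \<in> \<Omega>" and c: "0 \<le> c"
  shows "\<bar>g t - g s\<bar> \<le> real (card V) * c"
proof -
  have *: "\<bar>g (flip D s) - g s\<bar> \<le> real (card D) * c" if "finite D" "D \<subseteq> V" for D
    using that
  proof (induction D rule: finite_induct)
    case empty
    then show ?case by (simp add: flip_def)
  next
    case (insert x D)
    have "flip (insert x D) s = flip {x} (flip D s)" using insert by (auto simp: flip_def)
    moreover have "\<bar>g (flip {x} (flip D s)) - g (flip D s)\<bar> \<le> c"
      using insert s by (intro osc flip_in_spin_configs) auto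
    ultimately show ?case using insert by (simp add: distrib_right)
  qed
  define D where "D = {x\<in>V. t x \<noteq> s x}"
  have "t = flip D s"
  proof
    fix x show "t x = flip D s x"
      using s t spin_neq[OF s t, of x] by (cases "x \<in> V") (auto simp: D_def flip_def spin_configs_iff extensional_def)
  qed
  moreover have "real (card D) * c \<le> real (card V) * c"
    using c finite_V by (intro mult_right_mono) (auto simp: D_def intro!: card_mono)
  ultimately show ?thesis using *[of D] finite_V by (auto simp: D_def)
qed

text \<open>If \<open>g\<close> has mean zero, then \<open>g s\<close> is the average of
  \<open>g s - g t\<close> over \<open>t\<close>. Uniform decay of oscillations thus becomes the
  growth bound needed for \<open>self_adjoint_form_le_growth\<close>.\<close>

lemma sum_square_le_osc:
  assumes osc: "\<And>s u. s \<in> \<Omega> \<Longrightarrow> u \<in> V \<Longrightarrow> \<bar>g (flip {u} s) - g s\<bar> \<le> c"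
    and c: "0 \<le> c" and zero: "(\<Sum>s\<in>\<Omega>. w s * g s) = 0"
  shows "(\<Sum>s\<in>\<Omega>. w s * (g s)\<^sup>2) \<le> (\<Sum>s\<in>\<Omega>. w s) * (real (card V) * c)\<^sup>2"
proof -
  have "(g s)\<^sup>2 \<le> (real (card V) * c)\<^sup>2" if s: "s \<in> \<Omega>" for s
  proof -
    have W: "0 < (\<Sum>t\<in>\<Omega>. w t)" using s finite_\<Omega> w_pos by (intro sum_pos) auto
    have "(\<Sum>t\<in>\<Omega>. w t) * g s = (\<Sum>t\<in>\<Omega>. w t * (g s - g t))"
      using zero by (simp add: right_diff_distrib sum_subtractf sum_distrib_right)
    then have "(\<Sum>t\<in>\<Omega>. w t) * \<bar>g s\<bar> = \<bar>\<Sum>t\<in>\<Omega>. w t * (g s - g t)\<bar>"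
      using W by (metis abs_mult abs_of_pos)
    also have "\<dots> \<le> (\<Sum>t\<in>\<Omega>. w t * (real (card V) * c))"
    proof (intro order_trans[OF sum_abs] sum_mono)
      fix t assume "t \<in> \<Omega>"
      then have "\<bar>g s - g t\<bar> \<le> real (card V) * c" using diff_le_card_osc[OF osc _ s c] by blast
      then show "\<bar>w t * (g s - g t)\<bar> \<le> w t * (real (card V) * c)"
        using w_pos[of t] by (simp add: abs_mult)
    qed
    also have "\<dots> = (\<Sum>t\<in>\<Omega>. w t) * (real (card V) * c)" by (simp add: sum_distrib_right)
    finally have "\<bar>g s\<bar> \<le> real (card V) * c" using W by simp
    then show ?thesis by (metis abs_ge_zero power2_abs power_mono)
  qed
  then have "(\<Sum>s\<in>\<Omega>. w s * (g s)\<^sup>2) \<le> (\<Sum>s\<in>\<Omega>. w s * (real (card V) * c)\<^sup>2)"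
    using w_pos by (intro sum_mono mult_left_mono) (auto intro: less_imp_le)
  then show ?thesis by (simp add: sum_distrib_right)
qed

text \<open>The weights \<open>q\<close> stand for the law of the random set. A flip at
  \<open>v\<close> is felt only through sets containing \<open>v\<close>, of total weight at most
  \<open>\<delta>\<close>, so \<open>T\<close> shrinks oscillations by \<open>\<delta> * K\<close>.
  Since \<open>T\<close> also preserves mean zero, its iterates grow at no larger rate.\<close>

lemma sum_cond_square_le:
  assumes q: "\<And>U. U \<subseteq> V \<Longrightarrow> 0 \<le> q U" and K: "\<And>v. v \<in> V \<Longrightarrow> (\<Sum>u\<in>V. corr v u) \<le> K" "0 \<le> K"
    and \<delta>: "\<And>v. v \<in> V \<Longrightarrow> (\<Sum>U | U \<subseteq> V \<and> v \<in> U. q U) \<le> \<delta>" "0 \<le> \<delta>"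
    and zero: "(\<Sum>s\<in>\<Omega>. w s * f s) = 0"
  shows "(\<Sum>U\<in>Pow V. q U * (\<Sum>s\<in>\<Omega>. w s * (cond U f s)\<^sup>2)) \<le> \<delta> * K * (\<Sum>s\<in>\<Omega>. w s * (f s)\<^sup>2)"
proof -
  define T where "T = (\<lambda>f s. \<Sum>U\<in>Pow V. q U * cond U f s)"
  have T: "(\<Sum>s\<in>\<Omega>. w s * (T f s * g s)) = (\<Sum>U\<in>Pow V. q U * (\<Sum>s\<in>\<Omega>. w s * (cond U f s * g s)))" for f g
  proof -
    have "(\<Sum>s\<in>\<Omega>. w s * (T f s * g s)) = (\<Sum>s\<in>\<Omega>. \<Sum>U\<in>Pow V. q U * (w s * (cond U f s * g s)))"
      unfolding T_def by (simp add: sum_distrib_left sum_distrib_right mult_ac)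
    also have "\<dots> = (\<Sum>U\<in>Pow V. \<Sum>s\<in>\<Omega>. q U * (w s * (cond U f s * g s)))" by (rule sum.swap)
    finally show ?thesis by (simp add: sum_distrib_left)
  qed
  have cond_mult: "(\<Sum>s\<in>\<Omega>. w s * (cond U f s * g s)) = (\<Sum>s\<in>\<Omega>. w s * (cond U f s * cond U g s))" for U f g
    unfolding cond_def by (rule sum_class_mean_mult[OF finite_\<Omega> w_pos])
  have sym: "(\<Sum>s\<in>\<Omega>. w s * (T f s * g s)) = (\<Sum>s\<in>\<Omega>. w s * (f s * T g s))" for f g
  proof -
    have "(\<Sum>s\<in>\<Omega>. w s * (cond U f s * g s)) = (\<Sum>s\<in>\<Omega>. w s * (cond U g s * f s))" for U
      using cond_mult[of U f g] cond_mult[of U g f] by (simp add: mult.commute)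
    then show ?thesis using T[of f g] T[of g f] by (simp add: mult.commute)
  qed
  have T_zero: "(\<Sum>s\<in>\<Omega>. w s * T f s) = 0" if "(\<Sum>s\<in>\<Omega>. w s * f s) = 0" for f
  proof -
    have "(\<Sum>s\<in>\<Omega>. w s * cond U f s) = 0" for U
      using sum_class_mean[OF finite_\<Omega> w_pos, where F = "\<lambda>_. 1" and f = f and \<pi> = "\<lambda>t. restrict t U"] that
      by (simp add: cond_def)
    then show ?thesis using T[of f "\<lambda>_. 1"] by simp
  qed
  have T_osc: "\<bar>T f (flip {v} s) - T f s\<bar> \<le> (\<delta> * K) * c"
    if osc: "\<And>s u. s \<in> \<Omega> \<Longrightarrow> u \<in> V \<Longrightarrow> \<bar>f (flip {u} s) - f s\<bar> \<le> c" and v: "v \<in> V" and s: "s \<in> \<Omega>" for f c v s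
  proof -
    have c: "0 \<le> c" using osc[OF s v] by linarith
    have "\<bar>T f (flip {v} s) - T f s\<bar> = \<bar>\<Sum>U\<in>Pow V. q U * (cond U f (flip {v} s) - cond U f s)\<bar>"
      by (simp add: T_def right_diff_distrib sum_subtractf)
    also have "\<dots> \<le> (\<Sum>U\<in>Pow V. q U * (if v \<in> U then K * c else 0))"
    proof (intro order_trans[OF sum_abs] sum_mono)
      fix U assume "U \<in> Pow V"
      then show "\<bar>q U * (cond U f (flip {v} s) - cond U f s)\<bar> \<le> q U * (if v \<in> U then K * c else 0)"
        using cond_osc[of U s v f c K, OF _ s v osc K(1)[OF v]] q[of U]
        unfolding abs_mult by (intro mult_mono) auto
    qed
    also have "\<dots> = (\<Sum>U\<in>Pow V. if v \<in> U then q U * (K * c) else 0)"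
      by (intro sum.cong) auto
    also have "\<dots> = (\<Sum>U | U \<in> Pow V \<and> v \<in> U. q U * (K * c))"
      using finite_V by (intro sum.inter_filter[symmetric]) simp
    also have "\<dots> = (\<Sum>U | U \<subseteq> V \<and> v \<in> U. q U) * (K * c)"
      by (simp add: sum_distrib_right)
    also have "\<dots> \<le> \<delta> * (K * c)" using \<delta>(1)[OF v] K(2) c by (intro mult_right_mono) auto
    finally show ?thesis by (simp add: mult.assoc)
  qed
  \<comment> \<open>A crude bound on the initial oscillation is enough, since it enters the constant
    and not the growth rate.\<close>
  define c where "c = 2 * (\<Sum>s\<in>\<Omega>. \<bar>f s\<bar>)"
  have c: "0 \<le> c" by (simp add: c_def sum_nonneg)
  have f_le: "\<bar>f s\<bar> \<le> (\<Sum>s\<in>\<Omega>. \<bar>f s\<bar>)" if "s \<in> \<Omega>" for s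
    using that finite_\<Omega> by (intro member_le_sum) auto
  have iter: "(\<forall>s\<in>\<Omega>. \<forall>v\<in>V. \<bar>(T ^^ m) f (flip {v} s) - (T ^^ m) f s\<bar> \<le> (\<delta> * K) ^ m * c)
      \<and> (\<Sum>s\<in>\<Omega>. w s * (T ^^ m) f s) = 0" for m
  proof (induction m)
    case 0
    have "\<bar>f (flip {v} s) - f s\<bar> \<le> c" if "s \<in> \<Omega>" "v \<in> V" for s v
      using f_le[of s] f_le[of "flip {v} s"] that flip_in_spin_configs[of "{v}" V s] by (simp add: c_def)
    then show ?case using zero by simp
  next
    case (Suc m)
    then show ?case using T_osc[of "(T ^^ m) f" "(\<delta> * K) ^ m * c"] T_zero[of "(T ^^ m) f"]
      by (simp add: mult.assoc)
  qed
  have r: "0 \<le> \<delta> * K" using \<delta>(2) K(2) by simp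
  have "(\<Sum>s\<in>\<Omega>. w s * (f s * T f s)) \<le> (\<delta> * K) * (\<Sum>s\<in>\<Omega>. w s * (f s)\<^sup>2)"
  proof (rule self_adjoint_form_le_growth[OF _ sym _ r])
    show "0 \<le> w s" for s using w_pos by (rule less_imp_le)
    show "(\<Sum>s\<in>\<Omega>. w s * ((T ^^ m) f s)\<^sup>2) \<le> ((\<Sum>s\<in>\<Omega>. w s) * (real (card V) * c)\<^sup>2) * ((\<delta> * K) ^ m)\<^sup>2" for m
    proof -
      have "(\<Sum>s\<in>\<Omega>. w s * ((T ^^ m) f s)\<^sup>2) \<le> (\<Sum>s\<in>\<Omega>. w s) * (real (card V) * ((\<delta> * K) ^ m * c))\<^sup>2"
        using iter[of m] r c by (intro sum_square_le_osc) auto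
      then show ?thesis by (simp add: power_mult_distrib mult_ac)
    qed
  qed
  moreover have "(\<Sum>s\<in>\<Omega>. w s * (f s * T f s)) = (\<Sum>U\<in>Pow V. q U * (\<Sum>s\<in>\<Omega>. w s * (cond U f s)\<^sup>2))"
    using T[of f f] cond_mult[where f = f and g = f] by (simp add: sym power2_eq_square)
  ultimately show ?thesis by simp
qed

end

section \<open>The Edwards--Sokal coupling\<close>

definition ising_weight :: "'v set set \<Rightarrow> real \<Rightarrow> ('v \<Rightarrow> real) \<Rightarrow> real" where
  "ising_weight E \<beta> s = exp (\<beta> * (\<Sum>e\<in>E. \<Prod>x\<in>e. s x))"

definition fk_weight :: "'v set \<Rightarrow> 'v set set \<Rightarrow> real \<Rightarrow> 'v set set \<Rightarrow> real" where
  "fk_weight V E p \<omega> = 2 ^ num_clusters V \<omega> * (\<Prod>e\<in>E. if e \<in> \<omega> then p else 1 - p)"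

text \<open>For \<open>\<omega> \<subseteq> E\<close> these are the configurations that are constant
  on every cluster.\<close>

definition compatible :: "'v set \<Rightarrow> 'v set set \<Rightarrow> ('v \<Rightarrow> real) set" where
  "compatible V \<omega> = {s \<in> spin_configs V. \<forall>e\<in>\<omega>. agree s e}"

context finite_graph
begin

lemma finite_E: "finite E"
  by (rule finite_subset[of _ "Pow V"]) (use edges finite_V in auto)

lemma finite_spin_configs: "finite (spin_configs V)"
  unfolding spin_configs_def using finite_V by (intro finite_PiE) auto

lemma spin_configs_nonempty: "spin_configs V \<noteq> {}"
  by (auto simp: spin_configs_def PiE_eq_empty_iff)

lemma prod_edge:
  assumes "e \<in> E" "s \<in> spin_configs V"
  shows "(\<Prod>x\<in>e. s x) = (if agree s e then 1 else -1)"
proof -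
  obtain x y where e: "e = {x, y}" "x \<noteq> y" using edges[OF assms(1)] by (auto simp: card_2_iff)
  then have "s x = 1 \<or> s x = -1" "s y = 1 \<or> s y = -1"
    using edges[OF assms(1)] assms(2) by (auto simp: spin_configs_iff)
  then show ?thesis using e by (auto simp: agree_pair)
qed

lemma ising_weight_eq_prod:
  assumes "s \<in> spin_configs V"
  shows "ising_weight E \<beta> s = exp (- \<beta> * card E) * (\<Prod>e\<in>E. if agree s e then exp (2 * \<beta>) else 1)"
proof -
  have "ising_weight E \<beta> s = (\<Prod>e\<in>E. exp (\<beta> * (\<Prod>x\<in>e. s x)))"
    by (simp add: ising_weight_def sum_distrib_left exp_sum finite_E)
  also have "\<dots> = (\<Prod>e\<in>E. exp (- \<beta>) * (if agree s e then exp (2 * \<beta>) else 1))"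
    by (intro prod.cong) (simp_all add: prod_edge[OF _ assms] exp_add[symmetric])
  also have "\<dots> = exp (- \<beta> * card E) * (\<Prod>e\<in>E. if agree s e then exp (2 * \<beta>) else 1)"
    by (simp add: prod.distrib exp_of_nat_mult[symmetric] mult.commute)
  finally show ?thesis .
qed

text \<open>Each edge contributes \<open>exp \<beta>\<close> times \<open>p\<close> if its endpoints
  agree, plus \<open>1 - p\<close> in any case, where \<open>p = 1 - exp (- 2 * \<beta>)\<close>.
  Multiplying out, \<open>\<omega>\<close> collects the edges from which the first term is
  chosen.\<close>

lemma ising_weight_expansion:
  assumes "s \<in> spin_configs V"
  shows "ising_weight E \<beta> s = exp (\<beta> * card E) *
    (\<Sum>\<omega>\<in>Pow E. (\<Prod>e\<in>E. if e \<in> \<omega> then 1 - exp (- 2 * \<beta>) else exp (- 2 * \<beta>)) *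
      (if s \<in> compatible V \<omega> then 1 else 0))"
proof -
  let ?p = "1 - exp (- 2 * \<beta>)" and ?q = "exp (- 2 * \<beta>)"
  have "ising_weight E \<beta> s = (\<Prod>e\<in>E. exp (\<beta> * (\<Prod>x\<in>e. s x)))"
    by (simp add: ising_weight_def sum_distrib_left exp_sum finite_E)
  also have "\<dots> = (\<Prod>e\<in>E. exp \<beta> * (?p * (if agree s e then 1 else 0) + ?q))"
    by (intro prod.cong) (simp_all add: prod_edge[OF _ assms] exp_add[symmetric])
  also have "\<dots> = exp (\<beta> * card E) * (\<Prod>e\<in>E. ?p * (if agree s e then 1 else 0) + ?q)"
    by (simp add: prod.distrib exp_of_nat_mult[symmetric] mult.commute)
  also have "(\<Prod>e\<in>E. ?p * (if agree s e then 1 else 0) + ?q)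
      = (\<Sum>\<omega>\<in>Pow E. (\<Prod>e\<in>\<omega>. ?p * (if agree s e then 1 else 0)) * (\<Prod>e\<in>E - \<omega>. ?q))"
    by (rule prod_add[OF finite_E])
  also have "\<dots> = (\<Sum>\<omega>\<in>Pow E. (\<Prod>e\<in>E. if e \<in> \<omega> then ?p else ?q) * (if s \<in> compatible V \<omega> then 1 else 0))"
  proof (intro sum.cong refl)
    fix \<omega> assume "\<omega> \<in> Pow E"
    then have \<omega>: "\<omega> \<subseteq> E" "finite \<omega>" using finite_E finite_subset by auto
    have "(\<Prod>e\<in>E. if e \<in> \<omega> then ?p else ?q) = (\<Prod>e\<in>\<omega>. ?p) * (\<Prod>e\<in>E - \<omega>. ?q)"
    proof -
      have "(\<Prod>e\<in>E - \<omega>. if e \<in> \<omega> then ?p else ?q) = (\<Prod>e\<in>E - \<omega>. ?q)" by (rule prod.cong) auto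
      moreover have "(\<Prod>e\<in>\<omega>. if e \<in> \<omega> then ?p else ?q) = (\<Prod>e\<in>\<omega>. ?p)" by (rule prod.cong) auto
      ultimately show ?thesis
        using prod.subset_diff[OF \<omega>(1) finite_E, of "\<lambda>e. if e \<in> \<omega> then ?p else ?q"]
        by (simp only: mult.commute)
    qed
    moreover have "(\<Prod>e\<in>\<omega>. ?p * (if agree s e then 1 else 0))
        = (\<Prod>e\<in>\<omega>. ?p) * (if s \<in> compatible V \<omega> then 1 else 0)"
    proof -
      have "(\<Prod>e\<in>\<omega>. if agree s e then 1 else 0 :: real) = (if s \<in> compatible V \<omega> then 1 else 0)"
        using assms \<omega>(2) by (auto simp: compatible_def)
      then show ?thesis by (simp only: prod.distrib)
    qed
    ultimately show "(\<Prod>e\<in>\<omega>. ?p * (if agree s e then 1 else 0)) * (\<Prod>e\<in>E - \<omega>. ?q)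
        = (\<Prod>e\<in>E. if e \<in> \<omega> then ?p else ?q) * (if s \<in> compatible V \<omega> then 1 else 0)"
      by simp
  qed
  finally show ?thesis .
qed

text \<open>The joint weight of spins and open edges, summed in both orders.\<close>

lemma Edwards_Sokal:
  "(\<Sum>s\<in>spin_configs V. ising_weight E \<beta> s * g s) = exp (\<beta> * card E) *
    (\<Sum>\<omega>\<in>Pow E. (\<Prod>e\<in>E. if e \<in> \<omega> then 1 - exp (- 2 * \<beta>) else exp (- 2 * \<beta>)) * (\<Sum>s\<in>compatible V \<omega>. g s))"
proof -
  let ?b = "\<lambda>\<omega>. \<Prod>e\<in>E. if e \<in> \<omega> then 1 - exp (- 2 * \<beta>) else exp (- 2 * \<beta>)"
  have "(\<Sum>s\<in>spin_configs V. ising_weight E \<beta> s * g s)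
      = (\<Sum>s\<in>spin_configs V. \<Sum>\<omega>\<in>Pow E. exp (\<beta> * card E) * (?b \<omega> * (if s \<in> compatible V \<omega> then g s else 0)))"
    by (intro sum.cong) (auto simp: ising_weight_expansion sum_distrib_left sum_distrib_right intro!: sum.cong)
  also have "\<dots> = (\<Sum>\<omega>\<in>Pow E. \<Sum>s\<in>spin_configs V. exp (\<beta> * card E) * (?b \<omega> * (if s \<in> compatible V \<omega> then g s else 0)))"
    by (rule sum.swap)
  also have "\<dots> = exp (\<beta> * card E) * (\<Sum>\<omega>\<in>Pow E. ?b \<omega> * (\<Sum>s\<in>spin_configs V. if s \<in> compatible V \<omega> then g s else 0))"
    by (simp add: sum_distrib_left)
  also have "(\<lambda>\<omega>. \<Sum>s\<in>spin_configs V. if s \<in> compatible V \<omega> then g s else 0) = (\<lambda>\<omega>. \<Sum>s\<in>compatible V \<omega>. g s)"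
  proof
    fix \<omega>
    have "compatible V \<omega> = {s \<in> spin_configs V. s \<in> compatible V \<omega>}" by (auto simp: compatible_def)
    then show "(\<Sum>s\<in>spin_configs V. if s \<in> compatible V \<omega> then g s else 0) = (\<Sum>s\<in>compatible V \<omega>. g s)"
      using sum.inter_filter[OF finite_spin_configs, of g "\<lambda>s. s \<in> compatible V \<omega>"] by simp
  qed
  finally show ?thesis .
qed

end

section \<open>Clusters and their independent fair signs\<close>

definition bond_rel :: "'v set set \<Rightarrow> ('v \<times> 'v) set" where
  "bond_rel \<omega> = {(x, y). {x, y} \<in> \<omega>}"

lemma mem_cluster: "u \<in> cluster V \<omega> v \<longleftrightarrow> u \<in> V \<and> (v, u) \<in> (bond_rel \<omega>)\<^sup>*"
  by (simp add: cluster_def bond_rel_def)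

lemma bond_rel_sym: "(x, y) \<in> (bond_rel \<omega>)\<^sup>* \<Longrightarrow> (y, x) \<in> (bond_rel \<omega>)\<^sup>*"
  by (rule symD[OF sym_rtrancl]) (auto simp: sym_def bond_rel_def insert_commute)

lemma cluster_eq_iff:
  assumes "u \<in> V" "v \<in> V"
  shows "cluster V \<omega> u = cluster V \<omega> v \<longleftrightarrow> u \<in> cluster V \<omega> v"
proof
  assume "cluster V \<omega> u = cluster V \<omega> v"
  moreover have "u \<in> cluster V \<omega> u" using assms by (simp add: mem_cluster)
  ultimately show "u \<in> cluster V \<omega> v" by simp
next
  assume "u \<in> cluster V \<omega> v"
  then have "(v, u) \<in> (bond_rel \<omega>)\<^sup>*" by (simp add: mem_cluster)
  then show "cluster V \<omega> u = cluster V \<omega> v"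
    using bond_rel_sym[of v u \<omega>] by (auto simp: mem_cluster intro: rtrancl_trans)
qed

lemma cluster_subset: "cluster V \<omega> v \<subseteq> V"
  by (auto simp: mem_cluster)

context finite_graph
begin

lemma compatible_cluster:
  assumes "s \<in> compatible V \<omega>" "u \<in> cluster V \<omega> v"
  shows "s u = s v"
proof -
  have "(v, u) \<in> (bond_rel \<omega>)\<^sup>*" using assms(2) by (simp add: mem_cluster)
  then show ?thesis
  proof (induction rule: rtrancl_induct)
    case (step y z)
    then have "agree s {y, z}" using assms(1) by (auto simp: compatible_def bond_rel_def)
    then have "s z = s y" by (simp add: agree_pair)
    then show ?case using step by simp
  qed simp
qed

lemma edge_cluster:
  assumes "\<omega> \<subseteq> E" "e \<in> \<omega>" "x \<in> e" "y \<in> e" "x \<in> cluster V \<omega> v"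
  shows "y \<in> cluster V \<omega> v"
proof (cases "x = y")
  case False
  obtain a b where "e = {a, b}" "a \<noteq> b" using edges[of e] assms by (auto simp: card_2_iff)
  then have "{x, y} \<in> \<omega>" using assms False by (auto simp: insert_commute)
  moreover have "y \<in> V" using edges[of e] assms by auto
  ultimately show ?thesis
    using assms(5) by (auto simp: mem_cluster bond_rel_def intro: rtrancl_into_rtrancl)
qed (use assms in simp)

lemma flip_compatible:
  assumes "\<omega> \<subseteq> E" "s \<in> compatible V \<omega>"
  shows "flip (cluster V \<omega> v) s \<in> compatible V \<omega>"
proof -
  have "e \<subseteq> cluster V \<omega> v \<or> e \<inter> cluster V \<omega> v = {}" if "e \<in> \<omega>" for e
    using edge_cluster[OF assms(1) that] by blast
  then show ?thesis
    using assms(2) cluster_subset[of V \<omega> v] by (auto simp: compatible_def flip_in_spin_configs agree_flip)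
qed

text \<open>Flipping the cluster of \<open>v\<close> is an involution of the compatible
  configurations that negates \<open>s v\<close> and keeps \<open>h\<close>, so the terms cancel.
  This expresses the fair sign of a cluster, independent of the other signs.\<close>

lemma sum_compatible_eq_0:
  assumes "\<omega> \<subseteq> E" "v \<in> V" "\<And>s. s \<in> compatible V \<omega> \<Longrightarrow> h (flip (cluster V \<omega> v) s) = h s"
  shows "(\<Sum>s\<in>compatible V \<omega>. s v * h s) = 0"
proof -
  let ?F = "flip (cluster V \<omega> v)"
  have "v \<in> cluster V \<omega> v" using assms by (simp add: mem_cluster)
  then have Fv: "?F s v = - s v" for s by (simp add: flip_def)
  have "bij_betw ?F (compatible V \<omega>) (compatible V \<omega>)"
    by (rule bij_betw_byWitness[where f' = ?F]) (auto simp: flip_compatible[OF assms(1)])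
  then have "(\<Sum>s\<in>compatible V \<omega>. s v * h s) = (\<Sum>s\<in>compatible V \<omega>. ?F s v * h (?F s))"
    by (rule sum.reindex_bij_betw[symmetric])
  also have "\<dots> = - (\<Sum>s\<in>compatible V \<omega>. s v * h s)"
    unfolding sum_negf[symmetric] by (intro sum.cong) (simp_all add: Fv assms(3))
  finally show ?thesis by simp
qed

text \<open>A compatible configuration amounts to a free choice of one sign per cluster;
  \<open>\<Psi>\<close> reads each sign off at an arbitrary representative.\<close>

lemma card_compatible:
  assumes "\<omega> \<subseteq> E"
  shows "card (compatible V \<omega>) = 2 ^ num_clusters V \<omega>"
proof -
  let ?C = "cluster V \<omega> ` V"
  define \<Phi> where "\<Phi> = (\<lambda>\<phi>. \<lambda>v\<in>V. \<phi> (cluster V \<omega> v) :: real)"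
  define \<Psi> where "\<Psi> = (\<lambda>s. \<lambda>C\<in>?C. s (SOME v. v \<in> C) :: real)"
  have some: "(SOME u. u \<in> cluster V \<omega> v) \<in> cluster V \<omega> v" if "v \<in> V" for v
    using that by (rule_tac x = v in someI) (simp add: mem_cluster)
  have "bij_betw \<Phi> (?C \<rightarrow>\<^sub>E {-1, 1}) (compatible V \<omega>)"
  proof (rule bij_betw_byWitness[where f' = \<Psi>])
    show "\<forall>\<phi>\<in>?C \<rightarrow>\<^sub>E {-1, 1}. \<Psi> (\<Phi> \<phi>) = \<phi>"
    proof (intro ballI ext)
      fix \<phi> :: "'v set \<Rightarrow> real" and C assume \<phi>: "\<phi> \<in> ?C \<rightarrow>\<^sub>E {-1, 1}"
      show "\<Psi> (\<Phi> \<phi>) C = \<phi> C"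
      proof (cases "C \<in> ?C")
        case True
        then obtain v where v: "v \<in> V" "C = cluster V \<omega> v" by auto
        let ?u = "SOME u. u \<in> C"
        have u: "?u \<in> C" unfolding v(2) by (rule some[OF v(1)])
        then have "?u \<in> V" using v(2) cluster_subset[of V \<omega> v] by auto
        then have "?u \<in> V" "cluster V \<omega> ?u = C"
          using cluster_eq_iff[of ?u V v \<omega>] u v by simp_all
        then show ?thesis using True by (simp add: \<Psi>_def \<Phi>_def)
      next
        case False
        then show ?thesis using \<phi> by (auto simp: \<Psi>_def PiE_def extensional_def)
      qed
    qed
    show "\<forall>s\<in>compatible V \<omega>. \<Phi> (\<Psi> s) = s"
    proof (intro ballI ext)
      fix s v assume s: "s \<in> compatible V \<omega>"
      show "\<Phi> (\<Psi> s) v = s v"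
      proof (cases "v \<in> V")
        case True
        then show ?thesis using compatible_cluster[OF s some[OF True]] by (simp add: \<Phi>_def \<Psi>_def)
      next
        case False
        then show ?thesis using s by (auto simp: \<Phi>_def compatible_def spin_configs_iff extensional_def)
      qed
    qed
    show "\<Phi> ` (?C \<rightarrow>\<^sub>E {-1, 1}) \<subseteq> compatible V \<omega>"
    proof
      fix s assume "s \<in> \<Phi> ` (?C \<rightarrow>\<^sub>E {-1, 1})"
      then obtain \<phi> where \<phi>: "\<phi> \<in> ?C \<rightarrow>\<^sub>E {-1, 1}" "s = \<Phi> \<phi>" by auto
      have "\<phi> C = 1 \<or> \<phi> C = -1" if "C \<in> ?C" for C using PiE_mem[OF \<phi>(1) that] by auto
      then have "s \<in> spin_configs V" by (simp add: \<phi>(2) \<Phi>_def spin_configs_iff)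
      moreover have "agree s e" if e: "e \<in> \<omega>" for e
        unfolding agree_def
      proof (intro ballI)
        fix x y assume xy: "x \<in> e" "y \<in> e"
        then have "x \<in> V" "y \<in> V" using edges[of e] assms e by auto
        moreover have "y \<in> cluster V \<omega> x"
          using edge_cluster[OF assms e xy, of x] \<open>x \<in> V\<close> by (simp add: mem_cluster)
        ultimately show "s x = s y" using cluster_eq_iff[of y V x \<omega>] by (simp add: \<phi> \<Phi>_def)
      qed
      ultimately show "s \<in> compatible V \<omega>" by (simp add: compatible_def)
    qed
    show "\<Psi> ` compatible V \<omega> \<subseteq> ?C \<rightarrow>\<^sub>E {-1, 1}"
    proof
      fix \<phi> assume "\<phi> \<in> \<Psi> ` compatible V \<omega>"
      then obtain s where s: "s \<in> spin_configs V" "\<phi> = \<Psi> s" by (auto simp: compatible_def)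
      have "s (SOME u. u \<in> C) \<in> {-1, 1}" if "C \<in> ?C" for C
      proof -
        obtain v where v: "v \<in> V" "C = cluster V \<omega> v" using \<open>C \<in> ?C\<close> by auto
        have "(SOME u. u \<in> C) \<in> V" using some[OF v(1)] cluster_subset[of V \<omega> v] v(2) by auto
        then show ?thesis using s(1) by (auto simp: spin_configs_iff)
      qed
      then show "\<phi> \<in> ?C \<rightarrow>\<^sub>E {-1, 1}" unfolding s(2) \<Psi>_def by (intro restrict_PiE_iff[THEN iffD2] ballI)
    qed
  qed
  then have "card (compatible V \<omega>) = card (?C \<rightarrow>\<^sub>E {-1, 1 :: real})" by (simp add: bij_betw_same_card)
  also have "\<dots> = 2 ^ num_clusters V \<omega>"
    using finite_V by (simp add: card_PiE num_clusters_def numeral_2_eq_2)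
  finally show ?thesis .
qed

lemma sum_compatible_pair:
  assumes "\<omega> \<subseteq> E" "v \<in> V" "u \<in> V"
  shows "(\<Sum>s\<in>compatible V \<omega>. s v * s u) = (if u \<in> cluster V \<omega> v then 2 ^ num_clusters V \<omega> else 0)"
proof (cases "u \<in> cluster V \<omega> v")
  case True
  have "s v * s u = 1" if "s \<in> compatible V \<omega>" for s
    using compatible_cluster[OF that True] that assms by (auto simp: compatible_def spin_configs_iff)
  then show ?thesis using True by (simp add: card_compatible[OF assms(1)])
next
  case False
  then show ?thesis
    using sum_compatible_eq_0[OF assms(1,2), of "\<lambda>s. s u"] by (simp add: flip_def)
qed

text \<open>Since \<open>2 ^ num_clusters V \<omega>\<close> counts the compatible configurations,
  \<open>h \<omega>\<close> is the conditional mean of \<open>g\<close> given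
  \<open>\<omega>\<close>, and the count becomes the cluster factor of the random cluster
  weight.\<close>

lemma Edwards_Sokal_fk:
  assumes "\<And>\<omega>. \<omega> \<subseteq> E \<Longrightarrow> (\<Sum>s\<in>compatible V \<omega>. g s) = 2 ^ num_clusters V \<omega> * h \<omega>"
  shows "(\<Sum>s\<in>spin_configs V. ising_weight E \<beta> s * g s)
    = exp (\<beta> * card E) * (\<Sum>\<omega>\<in>Pow E. fk_weight V E (1 - exp (- 2 * \<beta>)) \<omega> * h \<omega>)"
proof -
  have "(\<Prod>e\<in>E. if e \<in> \<omega> then 1 - exp (- 2 * \<beta>) else exp (- 2 * \<beta>)) * (\<Sum>s\<in>compatible V \<omega>. g s)
      = fk_weight V E (1 - exp (- 2 * \<beta>)) \<omega> * h \<omega>" if "\<omega> \<in> Pow E" for \<omega>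
  proof -
    have "1 - (1 - exp (- 2 * \<beta>)) = exp (- 2 * \<beta>)" by simp
    then show ?thesis using assms[of \<omega>] that unfolding fk_weight_def by (simp only: Pow_iff mult_ac)
  qed
  then show ?thesis unfolding Edwards_Sokal by (simp only: cong: sum.cong)
qed

lemma sum_ising_weight:
  "(\<Sum>s\<in>spin_configs V. ising_weight E \<beta> s)
    = exp (\<beta> * card E) * (\<Sum>\<omega>\<in>Pow E. fk_weight V E (1 - exp (- 2 * \<beta>)) \<omega>)"
  using Edwards_Sokal_fk[of "\<lambda>_. 1" "\<lambda>_. 1" \<beta>] by (simp add: card_compatible)

lemma sum_ising_pair:
  assumes "v \<in> V" "u \<in> V"
  shows "(\<Sum>s\<in>spin_configs V. ising_weight E \<beta> s * (s v * s u)) = exp (\<beta> * card E) *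
    (\<Sum>\<omega>\<in>Pow E. fk_weight V E (1 - exp (- 2 * \<beta>)) \<omega> * of_bool (u \<in> cluster V \<omega> v))"
  by (rule Edwards_Sokal_fk[where g = "\<lambda>s. s v * s u" and h = "\<lambda>\<omega>. of_bool (u \<in> cluster V \<omega> v)"])
    (simp add: sum_compatible_pair assms)

lemma sum_of_bool_cluster: "(\<Sum>u\<in>V. of_bool (u \<in> cluster V \<omega> v)) = real (card (cluster V \<omega> v))"
  using finite_V cluster_subset[of V \<omega> v] by (simp add: sum.If_cases of_bool_def Int_absorb1)

text \<open>Expanding the square gives all two-point functions, and those are connection indicators
  given \<open>\<omega>\<close>. This is the denominator of the clue of the magnetization.\<close>

lemma sum_ising_magnetization:
  "(\<Sum>s\<in>spin_configs V. ising_weight E \<beta> s * (\<Sum>v\<in>V. s v)\<^sup>2) = exp (\<beta> * card E) *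
    (\<Sum>\<omega>\<in>Pow E. fk_weight V E (1 - exp (- 2 * \<beta>)) \<omega> * (\<Sum>v\<in>V. real (card (cluster V \<omega> v))))"
proof (rule Edwards_Sokal_fk[where g = "\<lambda>s. (\<Sum>v\<in>V. s v)\<^sup>2"
      and h = "\<lambda>\<omega>. \<Sum>v\<in>V. real (card (cluster V \<omega> v))"])
  fix \<omega> assume \<omega>: "\<omega> \<subseteq> E"
  have "(\<Sum>s\<in>compatible V \<omega>. (\<Sum>v\<in>V. s v)\<^sup>2) = (\<Sum>s\<in>compatible V \<omega>. \<Sum>v\<in>V. \<Sum>u\<in>V. s v * s u)"
    by (simp only: power2_eq_square sum_product)
  also have "\<dots> = (\<Sum>v\<in>V. \<Sum>s\<in>compatible V \<omega>. \<Sum>u\<in>V. s v * s u)"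
    by (rule sum.swap)
  also have "\<dots> = (\<Sum>v\<in>V. \<Sum>u\<in>V. \<Sum>s\<in>compatible V \<omega>. s v * s u)"
    by (rule sum.cong[OF refl sum.swap])
  also have "\<dots> = (\<Sum>v\<in>V. \<Sum>u\<in>V. 2 ^ num_clusters V \<omega> * of_bool (u \<in> cluster V \<omega> v))"
    by (intro sum.cong refl) (simp add: sum_compatible_pair[OF \<omega>])
  also have "\<dots> = 2 ^ num_clusters V \<omega> * (\<Sum>v\<in>V. real (card (cluster V \<omega> v)))"
    by (simp add: sum_distrib_left[symmetric] sum_of_bool_cluster)
  finally show "(\<Sum>s\<in>compatible V \<omega>. (\<Sum>v\<in>V. s v)\<^sup>2)
      = 2 ^ num_clusters V \<omega> * (\<Sum>v\<in>V. real (card (cluster V \<omega> v)))" .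
qed

end

text \<open>Union bound over the sites of \<open>C\<close>.\<close>

lemma sum_indicator_le:
  fixes q :: "'a set \<Rightarrow> real"
  assumes "finite V" "C \<subseteq> V" and q: "\<And>U. U \<subseteq> V \<Longrightarrow> 0 \<le> q U"
    and \<delta>: "\<And>v. v \<in> V \<Longrightarrow> (\<Sum>U | U \<subseteq> V \<and> v \<in> U. q U) \<le> \<delta>"
  shows "(\<Sum>U\<in>Pow V. q U * of_bool (C \<inter> U \<noteq> {})) \<le> \<delta> * real (card C)"
proof -
  have C: "finite C" using assms(1,2) finite_subset by blast
  have "(\<Sum>U\<in>Pow V. q U * of_bool (C \<inter> U \<noteq> {})) \<le> (\<Sum>U\<in>Pow V. q U * (\<Sum>u\<in>C. of_bool (u \<in> U)))"
  proof (intro sum_mono mult_left_mono)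
    fix U assume "U \<in> Pow V"
    then show "0 \<le> q U" by (simp add: q)
    show "(of_bool (C \<inter> U \<noteq> {}) :: real) \<le> (\<Sum>u\<in>C. of_bool (u \<in> U))"
    proof (cases "C \<inter> U = {}")
      case True
      then show ?thesis by (simp add: sum_nonneg)
    next
      case False
      then obtain u where u: "u \<in> C" "u \<in> U" by auto
      have "(of_bool (u \<in> U) :: real) \<le> (\<Sum>u\<in>C. of_bool (u \<in> U))"
        using u C by (intro member_le_sum) auto
      then show ?thesis using u False by simp
    qed
  qed
  also have "\<dots> = (\<Sum>u\<in>C. \<Sum>U\<in>Pow V. q U * of_bool (u \<in> U))"
    unfolding sum_distrib_left by (rule sum.swap)
  also have "\<dots> \<le> (\<Sum>u\<in>C. \<delta>)"
  proof (rule sum_mono)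
    fix u assume "u \<in> C"
    then have u: "u \<in> V" using assms(2) by auto
    have "(\<Sum>U\<in>Pow V. q U * of_bool (u \<in> U)) = (\<Sum>U\<in>Pow V. if u \<in> U then q U else 0)"
      by (rule sum.cong) auto
    also have "\<dots> = (\<Sum>U | U \<in> Pow V \<and> u \<in> U. q U)"
      using assms(1) by (intro sum.inter_filter[symmetric]) simp
    also have "\<dots> \<le> \<delta>" using \<delta>[OF u] by simp
    finally show "(\<Sum>U\<in>Pow V. q U * of_bool (u \<in> U)) \<le> \<delta>" .
  qed
  finally show ?thesis by (simp add: mult.commute)
qed

lemma class_mean_scale:
  assumes "c \<noteq> 0" "\<And>t. t \<in> A \<Longrightarrow> w' t = c * w t"
  shows "class_mean A w' \<pi> f s = class_mean A w \<pi> f s"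
proof -
  have "(\<Sum>t\<in>{t\<in>A. \<pi> t = \<pi> s}. w' t * g t) = c * (\<Sum>t\<in>{t\<in>A. \<pi> t = \<pi> s}. w t * g t)" for g
    unfolding sum_distrib_left by (rule sum.cong) (auto simp: assms(2))
  from this[of f] this[of "\<lambda>_. 1"] show ?thesis
    using assms(1) by (simp add: class_mean_def)
qed

section \<open>Second moments of Ising conditional expectations\<close>

context finite_graph
begin

definition ising_cond :: "real \<Rightarrow> 'v set \<Rightarrow> (('v \<Rightarrow> real) \<Rightarrow> real) \<Rightarrow> ('v \<Rightarrow> real) \<Rightarrow> real" where
  "ising_cond \<beta> U = class_mean (spin_configs V) (ising_weight E \<beta>) (\<lambda>t. restrict t U)"

lemma ising_weight_pos: "0 < ising_weight E \<beta> s"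
  by (simp add: ising_weight_def)

lemma ising_cond_flip:
  assumes "R \<inter> U = {}"
  shows "ising_cond \<beta> U f (flip R s) = ising_cond \<beta> U f s"
proof -
  have "restrict (flip R s) U = restrict s U" using assms by (auto simp: flip_def fun_eq_iff restrict_def)
  then show ?thesis by (simp add: ising_cond_def class_mean_def)
qed

text \<open>Let \<open>X\<close> be the conditional expectation of the total spin. Its squared norm
  is its inner product with the total spin, where only the clusters that meet \<open>U\<close>
  contribute. So it is at most the second moment of the spin carried by these clusters.\<close>

lemma sum_ising_cond_magnetization_le:
  assumes "0 \<le> \<beta>" "U \<subseteq> V"
  shows "(\<Sum>s\<in>spin_configs V. ising_weight E \<beta> s * (ising_cond \<beta> U (\<lambda>s. \<Sum>v\<in>V. s v) s)\<^sup>2)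
    \<le> exp (\<beta> * card E) * (\<Sum>\<omega>\<in>Pow E. fk_weight V E (1 - exp (- 2 * \<beta>)) \<omega> *
        (\<Sum>v\<in>V. real (card (cluster V \<omega> v)) * of_bool (cluster V \<omega> v \<inter> U \<noteq> {})))"
proof -
  define X where "X = ising_cond \<beta> U (\<lambda>s. \<Sum>v\<in>V. s v)"
  define b where "b = (\<lambda>\<omega>. \<Prod>e\<in>E. if e \<in> \<omega> then 1 - exp (- 2 * \<beta>) else exp (- 2 * \<beta>))"
  define H where "H = (\<lambda>\<omega>. {v\<in>V. cluster V \<omega> v \<inter> U \<noteq> {}})"
  let ?I = "ising_weight E \<beta>" and ?c = "exp (\<beta> * card E)" and ?\<Omega> = "spin_configs V"
  have b: "0 \<le> b \<omega>" for \<omega> using assms(1) unfolding b_def by (intro prod_nonneg) auto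
  have ES: "(\<Sum>s\<in>?\<Omega>. ?I s * g s) = ?c * (\<Sum>\<omega>\<in>Pow E. b \<omega> * (\<Sum>s\<in>compatible V \<omega>. g s))" for g
    unfolding b_def by (rule Edwards_Sokal)
  have "(\<Sum>s\<in>?\<Omega>. ?I s * (X s * X s)) = (\<Sum>s\<in>?\<Omega>. ?I s * ((\<Sum>v\<in>V. s v) * X s))"
    unfolding X_def ising_cond_def
    by (rule sum_class_mean[OF finite_spin_configs ising_weight_pos class_mean_cong])
  also have "\<dots> = ?c * (\<Sum>\<omega>\<in>Pow E. b \<omega> * (\<Sum>s\<in>compatible V \<omega>. (\<Sum>v\<in>V. s v) * X s))"
    by (rule ES)
  \<comment> \<open>\<open>X\<close> depends only on spins in \<open>U\<close>, hence is unchanged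
    by flipping a cluster that misses \<open>U\<close>; the sign of that cluster averages to
    zero.\<close>
  also have "\<dots> = ?c * (\<Sum>\<omega>\<in>Pow E. b \<omega> * (\<Sum>s\<in>compatible V \<omega>. (\<Sum>v\<in>H \<omega>. s v) * X s))"
  proof (rule arg_cong[where f = "\<lambda>x. ?c * x"], rule sum.cong[OF refl])
    fix \<omega> assume "\<omega> \<in> Pow E"
    then have \<omega>: "\<omega> \<subseteq> E" by simp
    have "(\<Sum>s\<in>compatible V \<omega>. (\<Sum>v\<in>V. s v) * X s) = (\<Sum>v\<in>V. \<Sum>s\<in>compatible V \<omega>. s v * X s)"
      unfolding sum_distrib_right by (rule sum.swap)
    also have "\<dots> = (\<Sum>v\<in>H \<omega>. \<Sum>s\<in>compatible V \<omega>. s v * X s)"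
    proof (rule sum.mono_neutral_right[OF finite_V])
      show "\<forall>v\<in>V - H \<omega>. (\<Sum>s\<in>compatible V \<omega>. s v * X s) = 0"
        using sum_compatible_eq_0[OF \<omega>] ising_cond_flip unfolding X_def H_def by blast
    qed (auto simp: H_def)
    also have "\<dots> = (\<Sum>s\<in>compatible V \<omega>. (\<Sum>v\<in>H \<omega>. s v) * X s)"
      unfolding sum_distrib_right by (rule sum.swap)
    finally show "b \<omega> * (\<Sum>s\<in>compatible V \<omega>. (\<Sum>v\<in>V. s v) * X s)
        = b \<omega> * (\<Sum>s\<in>compatible V \<omega>. (\<Sum>v\<in>H \<omega>. s v) * X s)"
      by (rule arg_cong[where f = "\<lambda>x. b \<omega> * x"])
  qed
  \<comment> \<open>The inequality \<open>a * b \<le> a\<^sup>2 / 2 + b\<^sup>2 / 2\<close>. Since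
    \<open>X\<close> does not depend on \<open>\<omega>\<close>, its half reassembles into half of
    the left-hand side.\<close>
  also have "\<dots> \<le> ?c * (\<Sum>\<omega>\<in>Pow E. b \<omega> * (\<Sum>s\<in>compatible V \<omega>. (\<Sum>v\<in>H \<omega>. s v)\<^sup>2 / 2 + X s * X s / 2))"
  proof -
    have "(\<Sum>v\<in>H \<omega>. s v) * X s \<le> (\<Sum>v\<in>H \<omega>. s v)\<^sup>2 / 2 + X s * X s / 2" for \<omega> s
      using zero_le_power2[of "(\<Sum>v\<in>H \<omega>. s v) - X s"] by (simp add: power2_eq_square algebra_simps)
    then show ?thesis by (intro mult_left_mono sum_mono b) auto
  qed
  also have "\<dots> = ?c * (\<Sum>\<omega>\<in>Pow E. b \<omega> * (\<Sum>s\<in>compatible V \<omega>. (\<Sum>v\<in>H \<omega>. s v)\<^sup>2)) / 2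
      + ?c * (\<Sum>\<omega>\<in>Pow E. b \<omega> * (\<Sum>s\<in>compatible V \<omega>. X s * X s)) / 2"
    by (simp add: sum.distrib distrib_left sum_divide_distrib[symmetric])
  also have "?c * (\<Sum>\<omega>\<in>Pow E. b \<omega> * (\<Sum>s\<in>compatible V \<omega>. X s * X s)) = (\<Sum>s\<in>?\<Omega>. ?I s * (X s * X s))"
    by (rule ES[symmetric])
  \<comment> \<open>absorbing the second term into the left-hand side\<close>
  finally have "(\<Sum>s\<in>?\<Omega>. ?I s * (X s * X s))
      \<le> ?c * (\<Sum>\<omega>\<in>Pow E. b \<omega> * (\<Sum>s\<in>compatible V \<omega>. (\<Sum>v\<in>H \<omega>. s v)\<^sup>2))" by simp
  also have "\<dots> = ?c * (\<Sum>\<omega>\<in>Pow E. fk_weight V E (1 - exp (- 2 * \<beta>)) \<omega> *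
        (\<Sum>v\<in>V. real (card (cluster V \<omega> v)) * of_bool (cluster V \<omega> v \<inter> U \<noteq> {})))"
  proof (rule arg_cong[where f = "\<lambda>x. ?c * x"], rule sum.cong[OF refl])
    fix \<omega> assume "\<omega> \<in> Pow E"
    then have \<omega>: "\<omega> \<subseteq> E" by simp
    have H: "u \<in> H \<omega>" if "v \<in> H \<omega>" "u \<in> cluster V \<omega> v" for u v
    proof -
      have "u \<in> V" using that cluster_subset[of V \<omega> v] by auto
      then show ?thesis using that cluster_eq_iff[of u V v \<omega>] by (simp add: H_def)
    qed
    have "(\<Sum>s\<in>compatible V \<omega>. (\<Sum>v\<in>H \<omega>. s v)\<^sup>2) = (\<Sum>s\<in>compatible V \<omega>. \<Sum>v\<in>H \<omega>. \<Sum>u\<in>H \<omega>. s v * s u)"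
      by (simp only: power2_eq_square sum_product)
    also have "\<dots> = (\<Sum>v\<in>H \<omega>. \<Sum>s\<in>compatible V \<omega>. \<Sum>u\<in>H \<omega>. s v * s u)" by (rule sum.swap)
    also have "\<dots> = (\<Sum>v\<in>H \<omega>. \<Sum>u\<in>H \<omega>. \<Sum>s\<in>compatible V \<omega>. s v * s u)"
      by (rule sum.cong[OF refl sum.swap])
    also have "\<dots> = (\<Sum>v\<in>H \<omega>. 2 ^ num_clusters V \<omega> * real (card (cluster V \<omega> v)))"
    proof (rule sum.cong[OF refl])
      fix v assume v: "v \<in> H \<omega>"
      have "(\<Sum>u\<in>H \<omega>. \<Sum>s\<in>compatible V \<omega>. s v * s u)
          = (\<Sum>u\<in>H \<omega>. if u \<in> cluster V \<omega> v then 2 ^ num_clusters V \<omega> else 0)"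
        using v by (intro sum.cong sum_compatible_pair[OF \<omega>]) (auto simp: H_def)
      also have "\<dots> = (\<Sum>u\<in>{u\<in>H \<omega>. u \<in> cluster V \<omega> v}. 2 ^ num_clusters V \<omega>)"
        using finite_V by (intro sum.inter_filter[symmetric]) (simp add: H_def)
      also have "{u\<in>H \<omega>. u \<in> cluster V \<omega> v} = cluster V \<omega> v" using H[OF v] by auto
      finally show "(\<Sum>u\<in>H \<omega>. \<Sum>s\<in>compatible V \<omega>. s v * s u)
          = 2 ^ num_clusters V \<omega> * real (card (cluster V \<omega> v))" by simp
    qed
    also have "\<dots> = 2 ^ num_clusters V \<omega> * (\<Sum>v\<in>H \<omega>. real (card (cluster V \<omega> v)))"
      by (rule sum_distrib_left[symmetric])
    also have "(\<Sum>v\<in>H \<omega>. real (card (cluster V \<omega> v)))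
        = (\<Sum>v\<in>V. if cluster V \<omega> v \<inter> U \<noteq> {} then real (card (cluster V \<omega> v)) else 0)"
      unfolding H_def by (rule sum.inter_filter[OF finite_V])
    also have "\<dots> = (\<Sum>v\<in>V. real (card (cluster V \<omega> v)) * of_bool (cluster V \<omega> v \<inter> U \<noteq> {}))"
      by (rule sum.cong) auto
    finally have *: "(\<Sum>s\<in>compatible V \<omega>. (\<Sum>v\<in>H \<omega>. s v)\<^sup>2) = 2 ^ num_clusters V \<omega> *
      (\<Sum>v\<in>V. real (card (cluster V \<omega> v)) * of_bool (cluster V \<omega> v \<inter> U \<noteq> {}))" .
    have "1 - (1 - exp (- 2 * \<beta>)) = exp (- 2 * \<beta>)" by simp
    then show "b \<omega> * (\<Sum>s\<in>compatible V \<omega>. (\<Sum>v\<in>H \<omega>. s v)\<^sup>2) = fk_weight V E (1 - exp (- 2 * \<beta>)) \<omega> *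
        (\<Sum>v\<in>V. real (card (cluster V \<omega> v)) * of_bool (cluster V \<omega> v \<inter> U \<noteq> {}))"
      unfolding * fk_weight_def b_def by (simp only: mult_ac)
  qed
  finally show ?thesis by (simp add: X_def power2_eq_square)
qed

lemma fk_weight_nonneg: "0 \<le> \<beta> \<Longrightarrow> 0 \<le> fk_weight V E (1 - exp (- 2 * \<beta>)) \<omega>"
  unfolding fk_weight_def by (intro mult_nonneg_nonneg prod_nonneg) auto

text \<open>Read off from the Ising partition function, where every term is positive.\<close>

lemma sum_fk_weight_pos: "0 < (\<Sum>\<omega>\<in>Pow E. fk_weight V E (1 - exp (- 2 * \<beta>)) \<omega>)"
proof -
  have "0 < (\<Sum>s\<in>spin_configs V. ising_weight E \<beta> s)"
    using finite_spin_configs spin_configs_nonempty ising_weight_pos by (intro sum_pos)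
  then show ?thesis unfolding sum_ising_weight by (simp add: zero_less_mult_iff)
qed

text \<open>On averaging over \<open>U\<close>, the union bound replaces the indicator that the
  cluster of \<open>v\<close> is met by \<open>\<delta>\<close> times its size, which produces the
  squared size.\<close>

lemma sum_ising_cond_magnetization:
  assumes "0 \<le> \<beta>" and q: "\<And>U. U \<subseteq> V \<Longrightarrow> 0 \<le> q U"
    and \<delta>: "\<And>v. v \<in> V \<Longrightarrow> (\<Sum>U | U \<subseteq> V \<and> v \<in> U. q U) \<le> \<delta>"
  shows "(\<Sum>U\<in>Pow V. q U * (\<Sum>s\<in>spin_configs V. ising_weight E \<beta> s * (ising_cond \<beta> U (\<lambda>s. \<Sum>v\<in>V. s v) s)\<^sup>2))
    \<le> \<delta> * (exp (\<beta> * card E) * (\<Sum>\<omega>\<in>Pow E. fk_weight V E (1 - exp (- 2 * \<beta>)) \<omega> *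
        (\<Sum>v\<in>V. (real (card (cluster V \<omega> v)))\<^sup>2)))"
proof -
  let ?f = "fk_weight V E (1 - exp (- 2 * \<beta>))" and ?c = "exp (\<beta> * card E)"
  let ?n = "\<lambda>\<omega> v. real (card (cluster V \<omega> v))"
  have "(\<Sum>U\<in>Pow V. q U * (\<Sum>s\<in>spin_configs V. ising_weight E \<beta> s * (ising_cond \<beta> U (\<lambda>s. \<Sum>v\<in>V. s v) s)\<^sup>2))
      \<le> (\<Sum>U\<in>Pow V. q U * (?c * (\<Sum>\<omega>\<in>Pow E. ?f \<omega> * (\<Sum>v\<in>V. ?n \<omega> v * of_bool (cluster V \<omega> v \<inter> U \<noteq> {})))))"
    using q by (intro sum_mono mult_left_mono sum_ising_cond_magnetization_le[OF assms(1)]) auto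
  also have "\<dots> = (\<Sum>U\<in>Pow V. \<Sum>\<omega>\<in>Pow E. \<Sum>v\<in>V. ?c * ?f \<omega> * ?n \<omega> v * (q U * of_bool (cluster V \<omega> v \<inter> U \<noteq> {})))"
    by (simp add: sum_distrib_left mult_ac)
  also have "\<dots> = (\<Sum>\<omega>\<in>Pow E. \<Sum>U\<in>Pow V. \<Sum>v\<in>V. ?c * ?f \<omega> * ?n \<omega> v * (q U * of_bool (cluster V \<omega> v \<inter> U \<noteq> {})))"
    by (rule sum.swap)
  also have "\<dots> = (\<Sum>\<omega>\<in>Pow E. \<Sum>v\<in>V. \<Sum>U\<in>Pow V. ?c * ?f \<omega> * ?n \<omega> v * (q U * of_bool (cluster V \<omega> v \<inter> U \<noteq> {})))"
    by (rule sum.cong[OF refl sum.swap])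
  also have "\<dots> = (\<Sum>\<omega>\<in>Pow E. \<Sum>v\<in>V. ?c * ?f \<omega> * ?n \<omega> v * (\<Sum>U\<in>Pow V. q U * of_bool (cluster V \<omega> v \<inter> U \<noteq> {})))"
    by (simp only: sum_distrib_left)
  also have "\<dots> \<le> (\<Sum>\<omega>\<in>Pow E. \<Sum>v\<in>V. ?c * ?f \<omega> * ?n \<omega> v * (\<delta> * ?n \<omega> v))"
    using fk_weight_nonneg[OF assms(1)]
    by (intro sum_mono mult_left_mono sum_indicator_le[OF finite_V cluster_subset q \<delta>]) auto
  also have "\<dots> = \<delta> * (?c * (\<Sum>\<omega>\<in>Pow E. ?f \<omega> * (\<Sum>v\<in>V. (?n \<omega> v)\<^sup>2)))"
    by (simp add: sum_distrib_left power2_eq_square mult_ac)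
  finally show ?thesis .
qed

text \<open>Transfers \<open>sum_cond_square_le\<close> to the Ising weight. By the coupling,
  \<open>corr v u\<close> is the probability that \<open>u\<close> lies in the cluster of
  \<open>v\<close>, so summing over \<open>u\<close> gives the expected size of that
  cluster.\<close>

lemma sum_ising_cond_le:
  assumes "0 \<le> \<beta>" and q: "\<And>U. U \<subseteq> V \<Longrightarrow> 0 \<le> q U"
    and \<delta>: "\<And>v. v \<in> V \<Longrightarrow> (\<Sum>U | U \<subseteq> V \<and> v \<in> U. q U) \<le> \<delta>" "0 \<le> \<delta>"
    and zero: "(\<Sum>s\<in>spin_configs V. ising_weight E \<beta> s * f s) = 0"
  shows "(\<Sum>U\<in>Pow V. q U * (\<Sum>s\<in>spin_configs V. ising_weight E \<beta> s * (ising_cond \<beta> U f s)\<^sup>2))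
    \<le> \<delta> * ((\<Sum>\<omega>\<in>Pow E. fk_weight V E (1 - exp (- 2 * \<beta>)) \<omega> * real (Max ((\<lambda>v. card (cluster V \<omega> v)) ` V)))
        / (\<Sum>\<omega>\<in>Pow E. fk_weight V E (1 - exp (- 2 * \<beta>)) \<omega>))
      * (\<Sum>s\<in>spin_configs V. ising_weight E \<beta> s * (f s)\<^sup>2)"
proof -
  let ?f = "fk_weight V E (1 - exp (- 2 * \<beta>))" and ?\<Omega> = "spin_configs V"
  let ?max = "\<lambda>\<omega>. real (Max ((\<lambda>v. card (cluster V \<omega> v)) ` V))"
  define K where "K = (\<Sum>\<omega>\<in>Pow E. ?f \<omega> * ?max \<omega>) / (\<Sum>\<omega>\<in>Pow E. ?f \<omega>)"
  \<comment> \<open>The maximum with \<open>0\<close> ensures \<open>0 < N\<close> also for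
    \<open>\<beta> = 0\<close>.\<close>
  obtain N :: nat where N: "2 * \<beta> / ln 2 < real N" "0 < N"
    using reals_Archimedean2[of "max 0 (2 * \<beta> / ln 2)"] by auto
  \<comment> \<open>each edge is split into \<open>N\<close> parallel bonds weak enough for the influence inequality\<close>
  define k where "k = exp (2 * \<beta> / N)"
  define L where "L = repeat_mset N (mset_set E)"
  have "2 * \<beta> / N \<le> ln 2" using N by (simp add: field_simps)
  then have "k \<le> exp (ln 2)" unfolding k_def by (subst exp_le_cancel_iff)
  then have k: "1 \<le> k" "k \<le> 2" using assms(1) by (auto simp: k_def)
  interpret bond_spins V k L
  proof
    show "finite V" "1 \<le> k" "k \<le> 2" using finite_V k by auto
    have "e \<in> E" if "e \<in># L" for e
      using that finite_E unfolding L_def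
      by (metis count_eq_zero_iff count_repeat_mset elem_mset_set mult_0_right)
    then show "bonds_in V L" using edges by (auto simp: bonds_in_def)
  qed
  have kN: "k ^ N = exp (2 * \<beta>)"
    using N by (simp add: k_def exp_of_nat_mult[symmetric])
  have bw: "bond_weight k L s = (\<Prod>e\<in>E. if agree s e then exp (2 * \<beta>) else 1)" for s
  proof -
    have "(\<Prod>e\<in>#repeat_mset n A. g e) = (\<Prod>e\<in>#A. g e) ^ n" for n A and g :: "'v set \<Rightarrow> real"
      by (induction n) auto
    then have "bond_weight k L s = (\<Prod>e\<in>E. if agree s e then k else 1) ^ N"
      by (simp add: bond_weight_def L_def prod_unfold_prod_mset)
    also have "\<dots> = (\<Prod>e\<in>E. if agree s e then exp (2 * \<beta>) else 1)"
      unfolding prod_power_distrib by (intro prod.cong) (auto simp: kN)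
    finally show ?thesis .
  qed
  let ?a = "exp (- \<beta> * card E)"
  have I: "ising_weight E \<beta> s = ?a * bond_weight k L s" if "s \<in> ?\<Omega>" for s
    using ising_weight_eq_prod[OF that, of \<beta>] by (simp add: bw)
  have I_sum: "(\<Sum>s\<in>?\<Omega>. ising_weight E \<beta> s * g s) = ?a * (\<Sum>s\<in>?\<Omega>. bond_weight k L s * g s)" for g
    unfolding sum_distrib_left by (rule sum.cong) (simp_all add: I mult.assoc)
  have cond_eq: "ising_cond \<beta> U f s = cond U f s" for U f s
    unfolding ising_cond_def cond_def by (rule class_mean_scale[where c = ?a]) (simp_all add: I)
  have corr_fk: "corr v u = (\<Sum>\<omega>\<in>Pow E. ?f \<omega> * of_bool (u \<in> cluster V \<omega> v)) / (\<Sum>\<omega>\<in>Pow E. ?f \<omega>)"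
    if "v \<in> V" "u \<in> V" for u v
  proof -
    have "corr v u = (?a * (\<Sum>s\<in>?\<Omega>. bond_weight k L s * (s v * s u))) / (?a * (\<Sum>s\<in>?\<Omega>. bond_weight k L s * 1))"
      by (simp add: corr_def mean_half)
    also have "\<dots> = (\<Sum>s\<in>?\<Omega>. ising_weight E \<beta> s * (s v * s u)) / (\<Sum>s\<in>?\<Omega>. ising_weight E \<beta> s * 1)"
      by (simp only: I_sum)
    finally show ?thesis
      unfolding sum_ising_pair[OF that] mult_1_right sum_ising_weight by simp
  qed
  have n_le: "real (card (cluster V \<omega> v)) \<le> ?max \<omega>" if "v \<in> V" for \<omega> v
    using that finite_V by (intro of_nat_mono Max_ge) auto
  have K: "(\<Sum>u\<in>V. corr v u) \<le> K" if v: "v \<in> V" for v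
  proof -
    have "(\<Sum>u\<in>V. corr v u) = (\<Sum>u\<in>V. \<Sum>\<omega>\<in>Pow E. ?f \<omega> * of_bool (u \<in> cluster V \<omega> v)) / (\<Sum>\<omega>\<in>Pow E. ?f \<omega>)"
      by (simp add: corr_fk v sum_divide_distrib)
    also have "(\<Sum>u\<in>V. \<Sum>\<omega>\<in>Pow E. ?f \<omega> * of_bool (u \<in> cluster V \<omega> v))
        = (\<Sum>\<omega>\<in>Pow E. \<Sum>u\<in>V. ?f \<omega> * of_bool (u \<in> cluster V \<omega> v))"
      by (rule sum.swap)
    also have "\<dots> = (\<Sum>\<omega>\<in>Pow E. ?f \<omega> * real (card (cluster V \<omega> v)))"
      by (simp only: sum_distrib_left[symmetric] sum_of_bool_cluster)
    \<comment> \<open>Here the expected size of one cluster is bounded by the expectation of the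
      largest size.\<close>
    also have "\<dots> / (\<Sum>\<omega>\<in>Pow E. ?f \<omega>) \<le> K"
      unfolding K_def using n_le[OF v] fk_weight_nonneg[OF assms(1)] sum_fk_weight_pos
      by (intro divide_right_mono sum_mono mult_left_mono) (auto intro: less_imp_le)
    finally show ?thesis .
  qed
  have K0: "0 \<le> K"
    unfolding K_def using fk_weight_nonneg[OF assms(1)] by (auto intro!: divide_nonneg_nonneg sum_nonneg)
  have zero': "(\<Sum>s\<in>?\<Omega>. bond_weight k L s * f s) = 0" using zero unfolding I_sum by simp
  have "(\<Sum>U\<in>Pow V. q U * (\<Sum>s\<in>?\<Omega>. bond_weight k L s * (cond U f s)\<^sup>2))
      \<le> \<delta> * K * (\<Sum>s\<in>?\<Omega>. bond_weight k L s * (f s)\<^sup>2)"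
    by (rule sum_cond_square_le[OF q K K0 \<delta> zero'])
  then have "?a * (\<Sum>U\<in>Pow V. q U * (\<Sum>s\<in>?\<Omega>. bond_weight k L s * (cond U f s)\<^sup>2))
      \<le> ?a * (\<delta> * K * (\<Sum>s\<in>?\<Omega>. bond_weight k L s * (f s)\<^sup>2))"
    by (intro mult_left_mono) auto
  moreover have "?a * (\<Sum>U\<in>Pow V. q U * (\<Sum>s\<in>?\<Omega>. bond_weight k L s * (cond U f s)\<^sup>2))
      = (\<Sum>U\<in>Pow V. q U * (\<Sum>s\<in>?\<Omega>. ising_weight E \<beta> s * (ising_cond \<beta> U f s)\<^sup>2))"
    unfolding I_sum cond_eq sum_distrib_left by (simp only: mult_ac)
  moreover have "?a * (\<delta> * K * (\<Sum>s\<in>?\<Omega>. bond_weight k L s * (f s)\<^sup>2))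
      = \<delta> * K * (\<Sum>s\<in>?\<Omega>. ising_weight E \<beta> s * (f s)\<^sup>2)"
    unfolding I_sum by (simp only: mult_ac)
  ultimately show ?thesis unfolding K_def[symmetric] by (simp only:)
qed

end

section \<open>Clue of an Ising sample\<close>

lemma space_weighted_measure [simp]: "space (weighted_measure A w) = A"
  and sets_weighted_measure [simp]: "sets (weighted_measure A w) = Pow A"
  by (simp_all add: weighted_measure_def space_point_measure sets_point_measure)

lemma integral_weighted_measure:
  fixes g :: "'a \<Rightarrow> real"
  assumes "finite A" "\<And>a. a \<in> A \<Longrightarrow> 0 \<le> w a"
  shows "(\<integral>a. g a \<partial>weighted_measure A w) = (\<Sum>a\<in>A. w a * g a) / (\<Sum>a\<in>A. w a)"
  unfolding weighted_measure_def using assms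
  by (subst lebesgue_integral_point_measure_finite)
    (auto simp: sum_divide_distrib intro!: divide_nonneg_nonneg sum_nonneg)

lemma integrable_weighted_measure:
  fixes g :: "'a \<Rightarrow> real"
  shows "finite A \<Longrightarrow> integrable (weighted_measure A w) g"
  unfolding weighted_measure_def by (rule integrable_point_measure_finite)

lemma (in prob_space) expectation_finite_valued:
  fixes h :: "'b \<Rightarrow> real"
  assumes "finite A" and X: "X \<in> measurable M (count_space A)"
  shows "(\<integral>x. h (X x) \<partial>M) = (\<Sum>a\<in>A. prob {x\<in>space M. X x = a} * h a)"
proof -
  have ev: "{x\<in>space M. X x = a} \<in> events" if "a \<in> A" for a
  proof -
    have "X -` {a} \<inter> space M \<in> events" using X that by (intro measurable_sets) auto
    then show ?thesis by (simp add: vimage_def Collect_conj_eq Int_commute)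
  qed
  have "(\<integral>x. h (X x) \<partial>M) = (\<integral>x. (\<Sum>a\<in>A. h a * indicator {x\<in>space M. X x = a} x) \<partial>M)"
  proof (rule Bochner_Integration.integral_cong)
    fix x assume x: "x \<in> space M"
    then have "X x \<in> A" using measurable_space[OF X] by simp
    then have "(\<Sum>a\<in>A. h a * indicator {x\<in>space M. X x = a} x) = (\<Sum>a\<in>A. if X x = a then h a else 0)"
      using x by (intro sum.cong) auto
    also have "\<dots> = h (X x)" using \<open>X x \<in> A\<close> assms(1) by simp
    finally show "h (X x) = (\<Sum>a\<in>A. h a * indicator {x\<in>space M. X x = a} x)" ..
  qed simp
  also have "\<dots> = (\<Sum>a\<in>A. \<integral>x. h a * indicator {x\<in>space M. X x = a} x \<partial>M)"
    using ev by (intro Bochner_Integration.integral_sum) (auto simp: emeasure_eq_measure)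
  also have "\<dots> = (\<Sum>a\<in>A. prob {x\<in>space M. X x = a} * h a)"
    using ev by (intro sum.cong) (auto simp: mult.commute)
  finally show ?thesis .
qed

lemma ising_eq_weighted_measure: "ising V E \<beta> = weighted_measure (spin_configs V) (ising_weight E \<beta>)"
  by (simp add: ising_def ising_weight_def[abs_def])

lemma random_cluster_2_eq: "random_cluster V E p 2 = weighted_measure (Pow E) (fk_weight V E p)"
  by (simp add: random_cluster_def fk_weight_def[abs_def])

section \<open>From an abstract sample to finite sums\<close>

locale ising_sample = finite_graph V E + prob_space M
  for V :: "'v set" and E :: "'v set set" and M :: "'w measure" +
  fixes \<beta> :: real and \<sigma> :: "'w \<Rightarrow> 'v \<Rightarrow> real"
  assumes \<sigma>: "\<sigma> \<in> measurable M (ising V E \<beta>)" and distr_\<sigma>: "distr M (ising V E \<beta>) \<sigma> = ising V E \<beta>"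
begin

abbreviation \<Omega> where "\<Omega> \<equiv> spin_configs V"
abbreviation (input) weight where "weight \<equiv> ising_weight E \<beta>"

definition ev :: "(('v \<Rightarrow> real) \<Rightarrow> real) \<Rightarrow> real" where
  "ev h = (\<Sum>s\<in>\<Omega>. weight s * h s) / (\<Sum>s\<in>\<Omega>. weight s)"

lemma \<sigma>_in: "x \<in> space M \<Longrightarrow> \<sigma> x \<in> \<Omega>"
  using measurable_space[OF \<sigma>] by (simp add: ising_eq_weighted_measure)

lemma measurable_ising: "h \<in> borel_measurable (ising V E \<beta>)"
  by (simp add: ising_eq_weighted_measure weighted_measure_def)

lemma integral_\<sigma>: "(\<integral>x. h (\<sigma> x) \<partial>M) = ev h"
proof -
  have "(\<integral>x. h (\<sigma> x) \<partial>M) = (\<integral>s. h s \<partial>distr M (ising V E \<beta>) \<sigma>)"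
    by (rule integral_distr[OF \<sigma> measurable_ising, symmetric])
  also have "\<dots> = ev h"
    unfolding distr_\<sigma> unfolding ev_def ising_eq_weighted_measure
    by (rule integral_weighted_measure) (simp_all add: finite_spin_configs ising_weight_pos less_imp_le)
  finally show ?thesis .
qed

lemma integrable_\<sigma>: "integrable M (\<lambda>x. h (\<sigma> x) :: real)"
proof -
  have "integrable (distr M (ising V E \<beta>) \<sigma>) h"
    unfolding distr_\<sigma> unfolding ising_eq_weighted_measure
    by (rule integrable_weighted_measure[OF finite_spin_configs])
  then show ?thesis by (rule integrable_distr[OF \<sigma>])
qed

lemma measurable_spin: "(\<lambda>x. \<sigma> x v) \<in> borel_measurable M"
  using measurable_compose[OF \<sigma> measurable_ising, of "\<lambda>s. s v"] .

lemma sets_spin_algebra_generator: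
  "(\<Union>v\<in>U. {(\<lambda>x. \<sigma> x v) -` B \<inter> space M | B. B \<in> sets borel}) \<subseteq> Pow (space M)"
  by auto

lemma space_spin_algebra [simp]: "space (spin_algebra M \<sigma> U) = space M"
  unfolding spin_algebra_def by (rule space_measure_of) (rule sets_spin_algebra_generator)

lemma sets_spin_algebra:
  "sets (spin_algebra M \<sigma> U) = sigma_sets (space M) (\<Union>v\<in>U. {(\<lambda>x. \<sigma> x v) -` B \<inter> space M | B. B \<in> sets borel})"
  unfolding spin_algebra_def by (rule sets_measure_of) (rule sets_spin_algebra_generator)

lemma subalgebra_spin_algebra: "subalgebra M (spin_algebra M \<sigma> U)"
proof -
  have "sets (spin_algebra M \<sigma> U) \<subseteq> sets M"
    unfolding sets_spin_algebra
    by (rule sets.sigma_sets_subset) (auto intro: measurable_sets[OF measurable_spin])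
  then show ?thesis by (simp add: subalgebra_def)
qed

text \<open>Membership depends only on the spins in \<open>U\<close>: this holds for the generators
  and survives complements and countable unions.\<close>

lemma spin_algebra_saturated:
  assumes "A \<in> sets (spin_algebra M \<sigma> U)" "x \<in> A" "y \<in> space M" "restrict (\<sigma> x) U = restrict (\<sigma> y) U"
  shows "y \<in> A"
proof -
  have "A \<subseteq> space M \<and> (\<forall>x\<in>space M. \<forall>y\<in>space M. restrict (\<sigma> x) U = restrict (\<sigma> y) U \<longrightarrow> x \<in> A \<longrightarrow> y \<in> A)"
    using assms(1) unfolding sets_spin_algebra
  proof (induction rule: sigma_sets.induct)
    case (Basic a)
    then obtain v B where v: "v \<in> U" "a = (\<lambda>x. \<sigma> x v) -` B \<inter> space M" by auto
    show ?case
    proof (intro conjI ballI impI)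
      show "a \<subseteq> space M" unfolding v(2) by auto
      fix x y assume y: "y \<in> space M" and r: "restrict (\<sigma> x) U = restrict (\<sigma> y) U" and x: "x \<in> a"
      have "\<sigma> x v = \<sigma> y v" using fun_cong[OF r, of v] v(1) by simp
      then show "y \<in> a" using x y unfolding v(2) by simp
    qed
  next
    case (Compl a)
    then show ?case by (metis Diff_iff Diff_subset)
  next
    case (Union a)
    have IH: "a i \<subseteq> space M"
      "\<forall>x\<in>space M. \<forall>y\<in>space M. restrict (\<sigma> x) U = restrict (\<sigma> y) U \<longrightarrow> x \<in> a i \<longrightarrow> y \<in> a i" for i
      using Union(2)[of i] by blast+
    show ?case
    proof (intro conjI ballI impI)
      show "(\<Union>i. a i) \<subseteq> space M" using IH(1) by blast
      fix x y assume xy: "x \<in> space M" "y \<in> space M" "restrict (\<sigma> x) U = restrict (\<sigma> y) U" "x \<in> (\<Union>i. a i)"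
      then obtain i where "x \<in> a i" by blast
      then have "y \<in> a i" using IH(2)[of i] xy by blast
      then show "y \<in> (\<Union>i. a i)" by blast
    qed
  qed simp
  moreover have "x \<in> space M" using assms(1,2) sets.sets_into_space by fastforce
  ultimately show ?thesis using assms by blast
qed

text \<open>Conversely, the classes of outcomes with the same spins on \<open>U\<close> are events,
  as finite intersections over \<open>U\<close>.\<close>

lemma cylinder_in_spin_algebra:
  assumes "U \<subseteq> V"
  shows "{x\<in>space M. restrict (\<sigma> x) U = restrict s U} \<in> sets (spin_algebra M \<sigma> U)"
proof -
  have U: "finite U" using assms finite_V finite_subset by blast
  have "{x\<in>space M. \<sigma> x v = s v} \<in> sets (spin_algebra M \<sigma> U)" if "v \<in> U" for v
  proof -
    have "{x\<in>space M. \<sigma> x v = s v} = (\<lambda>x. \<sigma> x v) -` {s v} \<inter> space M" by auto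
    then show ?thesis
      unfolding sets_spin_algebra using that by (intro sigma_sets.Basic) (auto intro!: bexI[of _ v] exI[of _ "{s v}"])
  qed
  then have "{x\<in>space (spin_algebra M \<sigma> U). \<forall>v\<in>U. \<sigma> x v = s v} \<in> sets (spin_algebra M \<sigma> U)"
    by (intro sets.sets_Collect_finite_All[OF _ U]) simp
  moreover have "restrict (\<sigma> x) U = restrict s U \<longleftrightarrow> (\<forall>v\<in>U. \<sigma> x v = s v)" for x
    by (auto simp: restrict_def fun_eq_iff)
  ultimately show ?thesis by simp
qed

lemma measurable_ising_cond:
  assumes "U \<subseteq> V"
  shows "(\<lambda>x. ising_cond \<beta> U f (\<sigma> x)) \<in> borel_measurable (spin_algebra M \<sigma> U)"
proof (rule measurableI)
  fix B :: "real set"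
  have const: "ising_cond \<beta> U f s = ising_cond \<beta> U f t" if "restrict s U = restrict t U" for s t
    using that by (simp add: ising_cond_def class_mean_def)
  have "(\<lambda>x. ising_cond \<beta> U f (\<sigma> x)) -` B \<inter> space (spin_algebra M \<sigma> U)
      = (\<Union>s\<in>{s\<in>\<Omega>. ising_cond \<beta> U f s \<in> B}. {x\<in>space M. restrict (\<sigma> x) U = restrict s U})"
  proof (intro set_eqI iffI)
    fix x assume "x \<in> (\<lambda>x. ising_cond \<beta> U f (\<sigma> x)) -` B \<inter> space (spin_algebra M \<sigma> U)"
    then show "x \<in> (\<Union>s\<in>{s\<in>\<Omega>. ising_cond \<beta> U f s \<in> B}. {x\<in>space M. restrict (\<sigma> x) U = restrict s U})"
      using \<sigma>_in by auto
  next
    fix x assume "x \<in> (\<Union>s\<in>{s\<in>\<Omega>. ising_cond \<beta> U f s \<in> B}. {x\<in>space M. restrict (\<sigma> x) U = restrict s U})"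
    then obtain s where s: "ising_cond \<beta> U f s \<in> B" "x \<in> space M" "restrict (\<sigma> x) U = restrict s U" by auto
    then show "x \<in> (\<lambda>x. ising_cond \<beta> U f (\<sigma> x)) -` B \<inter> space (spin_algebra M \<sigma> U)"
      using const[OF s(3)] by simp
  qed
  also have "\<dots> \<in> sets (spin_algebra M \<sigma> U)"
    using finite_spin_configs cylinder_in_spin_algebra[OF assms] by (intro sets.finite_UN) auto
  finally show "(\<lambda>x. ising_cond \<beta> U f (\<sigma> x)) -` B \<inter> space (spin_algebra M \<sigma> U) \<in> sets (spin_algebra M \<sigma> U)" .
qed simp

lemma ev_ising_cond:
  assumes "\<And>s t. s \<in> \<Omega> \<Longrightarrow> t \<in> \<Omega> \<Longrightarrow> restrict s U = restrict t U \<Longrightarrow> F s = F t"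
  shows "ev (\<lambda>s. ising_cond \<beta> U f s * F s) = ev (\<lambda>s. f s * F s)"
  unfolding ev_def ising_cond_def
  by (subst sum_class_mean[OF finite_spin_configs ising_weight_pos assms]) auto

text \<open>Identifies the abstract conditional expectation with the finite formula. Every event of
  the spin algebra is the preimage under \<open>\<sigma>\<close> of a set determined by the spins in
  \<open>U\<close>, so \<open>ev_ising_cond\<close> verifies the characterising integrals.\<close>

lemma real_cond_exp_spin_algebra:
  assumes "U \<subseteq> V"
  shows "AE x in M. real_cond_exp M (spin_algebra M \<sigma> U) (\<lambda>x. f (\<sigma> x)) x = ising_cond \<beta> U f (\<sigma> x)"
proof -
  interpret finite_measure_subalgebra M "spin_algebra M \<sigma> U"
    by unfold_locales (rule subalgebra_spin_algebra)
  show ?thesis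
  proof (rule real_cond_exp_charact[OF _ integrable_\<sigma> integrable_\<sigma> measurable_ising_cond[OF assms]])
    fix A assume A: "A \<in> sets (spin_algebra M \<sigma> U)"
    define S where "S = {s\<in>\<Omega>. \<exists>x\<in>A. restrict (\<sigma> x) U = restrict s U}"
    have "A \<subseteq> space M" using A sets.sets_into_space by fastforce
    then have ind: "indicator A x = (indicator S (\<sigma> x) :: real)" if "x \<in> space M" for x
      using spin_algebra_saturated[OF A] that \<sigma>_in by (auto simp: S_def indicator_def)
    have set: "(\<integral>x\<in>A. h (\<sigma> x) \<partial>M) = ev (\<lambda>s. h s * indicator S s)" for h :: "('v \<Rightarrow> real) \<Rightarrow> real"
      unfolding integral_\<sigma>[symmetric] set_lebesgue_integral_def
      by (rule Bochner_Integration.integral_cong) (simp_all add: ind mult.commute)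
    show "(\<integral>x\<in>A. f (\<sigma> x) \<partial>M) = (\<integral>x\<in>A. ising_cond \<beta> U f (\<sigma> x) \<partial>M)"
      unfolding set by (rule ev_ising_cond[symmetric]) (auto simp: S_def indicator_def)
  qed
qed

lemma ising_weight_flip:
  assumes "s \<in> \<Omega>"
  shows "weight (flip V s) = weight s"
proof -
  have "agree (flip V s) e = agree s e" if "e \<in> E" for e
    using edges[OF that] by (intro agree_flip) auto
  then show ?thesis
    using assms by (simp add: ising_weight_eq_prod flip_in_spin_configs)
qed

text \<open>The zero-field weight is invariant under the global flip. Odd functions therefore have
  mean zero, and their variances are second moments.\<close>

lemma sum_odd:
  assumes "odd_on_spins V f"
  shows "(\<Sum>s\<in>\<Omega>. weight s * f s) = 0"
proof -
  have "f (flip V s) = - f s" if "s \<in> \<Omega>" for s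
  proof -
    have "flip V s = (\<lambda>v\<in>V. - s v)" using that by (auto simp: flip_def spin_configs_iff extensional_def)
    then show ?thesis using assms that by (simp add: odd_on_spins_def)
  qed
  then have "(\<Sum>s\<in>\<Omega>. weight (flip V s) * f (flip V s)) = - (\<Sum>s\<in>\<Omega>. weight s * f s)"
    unfolding sum_negf[symmetric] by (intro sum.cong) (simp_all add: ising_weight_flip)
  then show ?thesis using sum_flip[of V V "\<lambda>s. weight s * f s"] by simp
qed

text \<open>Conditioning preserves mean zero, so both variances are second moments and the partition
  functions cancel. If the variance vanishes, division by zero gives the same default
  \<open>0\<close> as in the definition.\<close>

lemma clue_odd:
  assumes "odd_on_spins V f" "U \<subseteq> V"
  shows "clue M \<sigma> f U = (\<Sum>s\<in>\<Omega>. weight s * (ising_cond \<beta> U f s)\<^sup>2) / (\<Sum>s\<in>\<Omega>. weight s * (f s)\<^sup>2)"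
proof -
  let ?R = "real_cond_exp M (spin_algebra M \<sigma> U) (\<lambda>x. f (\<sigma> x))"
  have f0: "ev f = 0" using sum_odd[OF assms(1)] by (simp add: ev_def)
  have var: "variance (\<lambda>x. f (\<sigma> x)) = ev (\<lambda>s. (f s)\<^sup>2)"
    using integral_\<sigma>[of f] integral_\<sigma>[of "\<lambda>s. (f s)\<^sup>2"] f0 by simp
  have AE: "AE x in M. ?R x = ising_cond \<beta> U f (\<sigma> x)" by (rule real_cond_exp_spin_algebra[OF assms(2)])
  have "(\<integral>x. ?R x \<partial>M) = (\<integral>x. ising_cond \<beta> U f (\<sigma> x) \<partial>M)"
    using AE integrable_\<sigma> by (intro integral_cong_AE) auto
  also have "\<dots> = 0"
    unfolding integral_\<sigma> using ev_ising_cond[of U "\<lambda>_. 1" f] f0 by simp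
  finally have R0: "(\<integral>x. ?R x \<partial>M) = 0" .
  have "variance ?R = (\<integral>x. (ising_cond \<beta> U f (\<sigma> x))\<^sup>2 \<partial>M)"
    unfolding R0 using AE integrable_\<sigma>
    by (intro integral_cong_AE) (auto intro!: borel_measurable_power)
  then have varR: "variance ?R = ev (\<lambda>s. (ising_cond \<beta> U f s)\<^sup>2)" 
    using integral_\<sigma>[of "\<lambda>s. (ising_cond \<beta> U f s)\<^sup>2"] by simp
  have "0 < (\<Sum>s\<in>\<Omega>. weight s)"
    using finite_spin_configs spin_configs_nonempty ising_weight_pos by (intro sum_pos)
  then show ?thesis unfolding clue_def Let_def var varR by (simp add: ev_def)
qed

end

theorem proposition1p12:
  fixes V :: "'v set" and E :: "'v set set" and \<beta> :: real
    and M :: "'w measure" and \<sigma> :: "'w \<Rightarrow> 'v \<Rightarrow> real" and \<U> :: "'w \<Rightarrow> 'v set"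
  defines "FK \<equiv> random_cluster V E (1 - exp (- 2 * \<beta>)) 2"
  assumes "finite_graph V E"
    and "\<beta> \<ge> 0"
    and "prob_space M"
    and "distr M (ising V E \<beta>) \<sigma> = ising V E \<beta>"
    and "indep_rvs M (ising V E \<beta>) \<sigma> (count_space (Pow V)) \<U>"
  shows
    "(\<integral>x. clue M \<sigma> (magnetization V) (\<U> x) \<partial>M)
        \<le> revealment M V \<U> *
           ((\<Sum>v\<in>V. \<integral>\<omega>. real (card (cluster V \<omega> v)) ^ 2 \<partial>FK) /
            (\<Sum>v\<in>V. \<integral>\<omega>. real (card (cluster V \<omega> v)) \<partial>FK))
     \<and> (\<forall>f. odd_on_spins V f \<longrightarrow>
          (\<integral>x. clue M \<sigma> f (\<U> x) \<partial>M)
            \<le> revealment M V \<U> *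
               (\<integral>\<omega>. real (Max ((\<lambda>v. card (cluster V \<omega> v)) ` V)) \<partial>FK))"
proof -
  have \<sigma>: "\<sigma> \<in> measurable M (ising V E \<beta>)" and \<U>: "\<U> \<in> measurable M (count_space (Pow V))"
    using assms(6) by (auto simp: indep_rvs_def)
  interpret finite_graph V E by fact
  interpret prob_space M by fact
  interpret ising_sample V E M \<beta> \<sigma>
    by unfold_locales (fact \<sigma>, fact assms(5))
  let ?fk = "fk_weight V E (1 - exp (- 2 * \<beta>))" and ?I = "ising_weight E \<beta>" and ?c = "exp (\<beta> * card E)"
  let ?n = "\<lambda>\<omega> v. real (card (cluster V \<omega> v))"
  define q where "q = (\<lambda>U. prob {x\<in>space M. \<U> x = U})"
  define \<delta> where "\<delta> = revealment M V \<U>"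
  have q: "0 \<le> q U" for U by (simp add: q_def)
  have mean_\<U>: "(\<integral>x. h (\<U> x) \<partial>M) = (\<Sum>U\<in>Pow V. q U * h U)" for h :: "'v set \<Rightarrow> real"
    unfolding q_def by (rule expectation_finite_valued[OF _ \<U>]) (simp add: finite_V)
  have \<delta>: "(\<Sum>U | U \<subseteq> V \<and> j \<in> U. q U) \<le> \<delta>" if j: "j \<in> V" for j
  proof -
    have "(\<Sum>U | U \<subseteq> V \<and> j \<in> U. q U) = (\<Sum>U\<in>Pow V. if j \<in> U then q U else 0)"
      using sum.inter_filter[of "Pow V" q "\<lambda>U. j \<in> U"] finite_V by simp
    also have "\<dots> = (\<Sum>U\<in>Pow V. q U * of_bool (j \<in> U))"
      by (rule sum.cong) auto
    also have "\<dots> = (\<integral>x. of_bool (j \<in> \<U> x) \<partial>M)" by (rule mean_\<U>[symmetric])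
    also have "\<dots> = (\<integral>x. indicator {x\<in>space M. j \<in> \<U> x} x \<partial>M)"
      by (rule Bochner_Integration.integral_cong) auto
    also have "\<dots> = prob {x\<in>space M. j \<in> \<U> x}"
      by (simp add: Int_absorb2 Collect_mono)
    also have "\<dots> \<le> \<delta>"
      unfolding \<delta>_def revealment_def using j finite_V by (intro Max_ge) auto
    finally show ?thesis .
  qed
  have \<delta>0: "0 \<le> \<delta>"
  proof -
    obtain j where j: "j \<in> V" using V_nonempty by blast
    have "0 \<le> (\<Sum>U | U \<subseteq> V \<and> j \<in> U. q U)" by (rule sum_nonneg) (rule q)
    then show ?thesis using \<delta>[OF j] by linarith
  qed
  have clue_mean: "(\<integral>x. clue M \<sigma> f (\<U> x) \<partial>M)
      = (\<Sum>U\<in>Pow V. q U * (\<Sum>s\<in>\<Omega>. ?I s * (ising_cond \<beta> U f s)\<^sup>2)) / (\<Sum>s\<in>\<Omega>. ?I s * (f s)\<^sup>2)"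
    if "odd_on_spins V f" for f
    unfolding mean_\<U> sum_divide_distrib by (rule sum.cong) (simp_all add: clue_odd[OF that])
  have FK: "(\<integral>\<omega>. h \<omega> \<partial>FK) = (\<Sum>\<omega>\<in>Pow E. ?fk \<omega> * h \<omega>) / (\<Sum>\<omega>\<in>Pow E. ?fk \<omega>)" for h
    unfolding FK_def random_cluster_2_eq
    by (rule integral_weighted_measure[OF _ fk_weight_nonneg[OF assms(3)]]) (simp add: finite_E)
  have I_nonneg: "0 \<le> (\<Sum>s\<in>\<Omega>. ?I s * (h s)\<^sup>2)" for h
    by (intro sum_nonneg mult_nonneg_nonneg less_imp_le[OF ising_weight_pos]) simp

  have "(\<integral>x. clue M \<sigma> (magnetization V) (\<U> x) \<partial>M)
      \<le> \<delta> * ((\<Sum>v\<in>V. \<integral>\<omega>. ?n \<omega> v ^ 2 \<partial>FK) / (\<Sum>v\<in>V. \<integral>\<omega>. ?n \<omega> v \<partial>FK))"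
  proof -
    \<comment> \<open>The normalisation of the magnetization cancels between numerator and
      denominator of the clue.\<close>
    define N where "N = real (card V)"
    have N: "0 < N" using finite_V V_nonempty by (simp add: N_def card_gt_0_iff)
    have "magnetization V (\<lambda>v\<in>V. - s v) = - magnetization V s" for s
      by (simp add: magnetization_def sum_negf)
    then have odd: "odd_on_spins V (magnetization V)" by (simp add: odd_on_spins_def)
    have cond: "ising_cond \<beta> U (magnetization V) s = ising_cond \<beta> U (\<lambda>s. \<Sum>v\<in>V. s v) s / N" for U s
      by (simp add: ising_cond_def class_mean_def magnetization_def N_def sum_divide_distrib[symmetric])
    let ?A = "\<Sum>U\<in>Pow V. q U * (\<Sum>s\<in>\<Omega>. ?I s * (ising_cond \<beta> U (\<lambda>s. \<Sum>v\<in>V. s v) s)\<^sup>2)"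
    let ?B = "\<Sum>s\<in>\<Omega>. ?I s * (\<Sum>v\<in>V. s v)\<^sup>2"
    let ?S1 = "\<Sum>\<omega>\<in>Pow E. ?fk \<omega> * (\<Sum>v\<in>V. ?n \<omega> v)" and ?S2 = "\<Sum>\<omega>\<in>Pow E. ?fk \<omega> * (\<Sum>v\<in>V. (?n \<omega> v)\<^sup>2)"
    have "(\<integral>x. clue M \<sigma> (magnetization V) (\<U> x) \<partial>M) = (?A / N\<^sup>2) / (?B / N\<^sup>2)"
      unfolding clue_mean[OF odd]
      by (simp only: cond magnetization_def N_def[symmetric] power_divide times_divide_eq_right
          sum_divide_distrib[symmetric])
    also have "\<dots> = ?A / ?B" using N by simp
    also have "\<dots> \<le> \<delta> * (?c * ?S2) / ?B"
      by (intro divide_right_mono sum_ising_cond_magnetization assms(3) q \<delta> I_nonneg)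
    \<comment> \<open>The denominator \<open>?B\<close> equals \<open>?c * ?S1\<close>, so the
      factor \<open>?c\<close> drops out.\<close>
    also have "\<dots> = \<delta> * (?S2 / ?S1)"
      unfolding sum_ising_magnetization by simp
    also have "?S2 / ?S1 = (\<Sum>v\<in>V. \<integral>\<omega>. ?n \<omega> v ^ 2 \<partial>FK) / (\<Sum>v\<in>V. \<integral>\<omega>. ?n \<omega> v \<partial>FK)"
    proof -
      have "(\<Sum>v\<in>V. \<integral>\<omega>. h \<omega> v \<partial>FK) = (\<Sum>\<omega>\<in>Pow E. ?fk \<omega> * (\<Sum>v\<in>V. h \<omega> v)) / (\<Sum>\<omega>\<in>Pow E. ?fk \<omega>)" for h
      proof -
        have "(\<Sum>v\<in>V. \<integral>\<omega>. h \<omega> v \<partial>FK) = (\<Sum>v\<in>V. \<Sum>\<omega>\<in>Pow E. ?fk \<omega> * h \<omega> v) / (\<Sum>\<omega>\<in>Pow E. ?fk \<omega>)"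
          unfolding FK by (rule sum_divide_distrib[symmetric])
        also have "(\<Sum>v\<in>V. \<Sum>\<omega>\<in>Pow E. ?fk \<omega> * h \<omega> v) = (\<Sum>\<omega>\<in>Pow E. \<Sum>v\<in>V. ?fk \<omega> * h \<omega> v)"
          by (rule sum.swap)
        finally show ?thesis by (simp only: sum_distrib_left)
      qed
      then show ?thesis using sum_fk_weight_pos[of \<beta>] by simp
    qed
    finally show ?thesis .
  qed
  moreover have "(\<integral>x. clue M \<sigma> f (\<U> x) \<partial>M)
      \<le> \<delta> * (\<integral>\<omega>. real (Max ((\<lambda>v. card (cluster V \<omega> v)) ` V)) \<partial>FK)" if odd: "odd_on_spins V f" for f
  proof -
    let ?B = "\<Sum>s\<in>\<Omega>. ?I s * (f s)\<^sup>2"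
    let ?K = "\<integral>\<omega>. real (Max ((\<lambda>v. card (cluster V \<omega> v)) ` V)) \<partial>FK"
    have le: "(\<Sum>U\<in>Pow V. q U * (\<Sum>s\<in>\<Omega>. ?I s * (ising_cond \<beta> U f s)\<^sup>2)) \<le> \<delta> * ?K * ?B"
      unfolding FK by (rule sum_ising_cond_le[OF assms(3) q \<delta> \<delta>0 sum_odd[OF odd]])
    \<comment> \<open>Covers the case of vanishing variance, where the clue is
      \<open>0\<close>.\<close>
    have K: "0 \<le> \<delta> * ?K" using \<delta>0 by simp
    show ?thesis
    proof (cases "?B = 0")
      case True
      then show ?thesis using K by (simp add: clue_mean[OF odd])
    next
      case False
      then have "0 < ?B" using I_nonneg[of f] by simp
      then show ?thesis using le by (simp add: clue_mean[OF odd] pos_divide_le_eq)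
    qed
  qed
  ultimately show ?thesis unfolding \<delta>_def by blast
qed

end
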